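(* Let $(z_k)_{k\in\mathbb{N}}$ be a sequence of pairwise distinct complex numbers with $|z_k|\to\infty$, let $f$ be a Weierstrass map whose simple zeros are the points $z_1,z_2,\ldots$, let $n\ge2$, let $S(f)=\{(z,w)\in\mathbb{C}^2: w^n=f(z)\}$ be the infinite superelliptic curve with its tame translation structure, and let $\mathbb{C}^{\star}=\mathbb{C}\setminus\{z_k:k\in\mathbb{N}\}$. Then the Veech groups of $\mathbb{C}^{\star}$ and $S(f)$ are the same: $\Gamma(\mathbb{C}^{\star})=\Gamma(S(f))$.
   Context: Weierstrass map: for a sequence $(z_k)_{k\in\mathbb{N}}$ of distinct complex numbers with $|z_k|\to\infty$, a function $f(z)=h(z)z^{m}\prod_{k\ge 1,\,z_k\ne 0}\left(1-\frac{z}{z_k}\right)E_k(z)$, where $h$ is a zero-free entire function, $m=1$ if some $z_k=0$ and $m=0$ otherwise, and $E_k(z)=\exp\left[\sum_{s=1}^{d(k)}\frac1s\left(\frac{z}{z_k}\right)^s\right]$ with suitably large non-negative integers $d(k)$ (so that the product converges). Its zeros are simple and are exactly the points $z_k$. Translation structures: $\mathbb{C}^{\star}$ is a translation surface as an open subset of $\mathbb{C}$. Let $p_{\mathbf z}:S(f)\to\mathbb{C}$, $(z,w)\mapsto z$. The restriction $p_{\mathbf z}: S(f)\setminus\{(z_k,0):k\in\mathbb{N}\}\to\mathbb{C}^{\star}$ is an unramified covering of degree $n$, by which the translation structure of $\mathbb{C}^{\star}$ is pulled back; the cone points of $S(f)$ are exactly the points $(z_k,0)$. Veech group: identify $\mathbb{C}$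 with $\mathbb{R}^2$. An affine diffeomorphism $T:S\to S$ of a translation surface is a homeomorphism sending cone points to cone points which in the local coordinates of the translation atlas is a real-affine map $z\mapsto A\cdot z+t$ with $A\in{\rm GL}(2,\mathbb{R})$, $t\in\mathbb{C}$. ${\rm Aff}_+(S)$ is the group of orientation preserving affine diffeomorphisms of $S$. The differential of $T\in{\rm Aff}_+(S)$ is a constant matrix $D(T)\in{\rm GL}_+(2,\mathbb{R})$ (the group of real $2\times2$ matrices with positive determinant), and $D:{\rm Aff}_+(S)\to{\rm GL}_+(2,\mathbb{R})$ is a group homomorphism whose image $\Gamma(S)$ is the Veech group of $S$. The group ${\rm Aff}_+(\mathbb{C}^{\star})$ consists of the orientation preserving affine diffeomorphisms of $\mathbb{C}$ permuting the points of $(z_k)_{k\in\mathbb{N}}$. *)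

theory Defs
  imports "HOL-Complex_Analysis.Complex_Analysis"
begin

unbundle no fps_syntax

section \<open>Weierstrass maps\<close>

text \<open>
  The library's \<^term>\<open>weierstrass_factor n x\<close> is
  \<open>(1 - x) * exp (\<Sum>s=1..n. x ^ s / s)\<close>; indices \<open>k\<close> with \<open>z k = 0\<close> are skipped
  (contribute the factor 1).
\<close>

definition weierstrass_term :: "(nat \<Rightarrow> complex) \<Rightarrow> (nat \<Rightarrow> nat) \<Rightarrow> nat \<Rightarrow> complex \<Rightarrow> complex" where
  "weierstrass_term z d k x = (if z k = 0 then 1 else weierstrass_factor (d k) (x / z k))"

text \<open>
  Convergence of the product of functions means: convergence in the usual sense of infinite
  products at every point (after finitely many factors, to a nonzero limit), uniformly on
  compact sets.
\<close>

definition weierstrass_map :: "(nat \<Rightarrow> complex) \<Rightarrow> (complex \<Rightarrow> complex) \<Rightarrow> bool" where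
  "weierstrass_map z f \<longleftrightarrow>
     (\<exists>h d. h holomorphic_on UNIV \<and> (\<forall>x. h x \<noteq> 0) \<and>
        (\<forall>x. convergent_prod (\<lambda>k. weierstrass_term z d k x)) \<and>
        (\<forall>K. compact K \<longrightarrow>
           uniformly_convergent_on K (\<lambda>N x. \<Prod>k<N. weierstrass_term z d k x)) \<and>
        (\<forall>x. f x = h x * x ^ (if 0 \<in> range z then 1 else 0) *
                    (\<Prod>k. weierstrass_term z d k x)))"


section \<open>Translation surfaces with cone points\<close>

text \<open>
  A chart is a domain together with a complex coordinate on it (only the values of the
  coordinate on the domain are relevant). The atlas of a surface lives on its regular part,
  the complement of the cone points; the underlying topology includes the cone points.
\<close>

type_synonym 'a atlas = "('a set \<times> ('a \<Rightarrow> complex)) set"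

record 'a surface =
  total :: "'a topology"
  cone_points :: "'a set"
  atlas :: "'a atlas"

definition regular_part :: "'a surface \<Rightarrow> 'a topology" where
  "regular_part S = subtopology (total S) (topspace (total S) - cone_points S)"

definition translation_atlas :: "'a topology \<Rightarrow> 'a atlas \<Rightarrow> bool" where
  "translation_atlas X \<A> \<longleftrightarrow>
     (\<Union>(U, \<phi>)\<in>\<A>. U) = topspace X \<and>
     (\<forall>(U, \<phi>)\<in>\<A>. openin X U \<and> open (\<phi> ` U) \<and>
        homeomorphic_map (subtopology X U) (top_of_set (\<phi> ` U)) \<phi>) \<and>
     (\<forall>(U, \<phi>)\<in>\<A>. \<forall>(V, \<psi>)\<in>\<A>. \<forall>p\<in>U \<inter> V.
        \<exists>c W. openin X W \<and> p \<in> W \<and> W \<subseteq> U \<inter> V \<and> (\<forall>q\<in>W. \<psi> q = \<phi> q + c))"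

definition translation_surface :: "'a surface \<Rightarrow> bool" where
  "translation_surface S \<longleftrightarrow>
     cone_points S \<subseteq> topspace (total S) \<and> Hausdorff_space (total S) \<and>
     openin (total S) (topspace (regular_part S)) \<and>
     translation_atlas (regular_part S) (atlas S)"

text \<open>
  Pullback of an atlas on \<open>X\<close> along \<open>p : Y \<rightarrow> X\<close>: its charts are the charts of \<open>X\<close> composed
  with the restrictions of \<open>p\<close> to those open sets that \<open>p\<close> maps homeomorphically onto an
  open subset of a chart domain.
\<close>

definition pullback_atlas :: "'b topology \<Rightarrow> ('b \<Rightarrow> 'a) \<Rightarrow> 'a topology \<Rightarrow> 'a atlas \<Rightarrow> 'b atlas" where
  "pullback_atlas Y p X \<A> =
     {(U, \<phi> \<circ> p) | U V \<phi>. (V, \<phi>) \<in> \<A> \<and> openin Y U \<and> openin X (p ` U) \<and> p ` U \<subseteq> V \<and>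
        homeomorphic_map (subtopology Y U) (subtopology X (p ` U)) p}"


section \<open>Affine diffeomorphisms and the Veech group\<close>

text \<open>Action of real \<open>2 \<times> 2\<close> matrices on the complex plane, identified with the real plane.\<close>

definition mat_act :: "real^2^2 \<Rightarrow> complex \<Rightarrow> complex" (infixr "\<bullet>\<^sub>m" 75) where
  "A \<bullet>\<^sub>m x = (let v = A *v vector [Re x, Im x] in Complex (v $ 1) (v $ 2))"

text \<open>In local coordinates around \<open>p\<close> and \<open>T p\<close>, the map \<open>T\<close> is \<open>x \<mapsto> A \<bullet>\<^sub>m x + t\<close>.\<close>

definition affine_at :: "'a surface \<Rightarrow> ('a \<Rightarrow> 'a) \<Rightarrow> 'a \<Rightarrow> real^2^2 \<Rightarrow> bool" where
  "affine_at S T p A \<longleftrightarrow>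
     (\<forall>(U, \<phi>)\<in>atlas S. \<forall>(V, \<psi>)\<in>atlas S. p \<in> U \<longrightarrow> T p \<in> V \<longrightarrow>
        (\<exists>t W. openin (regular_part S) W \<and> p \<in> W \<and> W \<subseteq> U \<and>
           (\<forall>q\<in>W. T q \<in> V \<and> \<psi> (T q) = A \<bullet>\<^sub>m \<phi> q + t)))"

text \<open>
  The cone points are required to be mapped onto the cone points, so that regular points are
  mapped to regular points and inverses are again affine. Maps are total functions, of which
  only the values on the surface matter.
\<close>

definition affine_diffeos :: "'a surface \<Rightarrow> ('a \<Rightarrow> 'a) set" where
  "affine_diffeos S =
     {T. homeomorphic_map (total S) (total S) T \<and> T ` cone_points S = cone_points S \<and>
         (\<forall>p\<in>topspace (regular_part S). \<exists>A. invertible A \<and> affine_at S T p A)}"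

definition affine_diffeos_plus :: "'a surface \<Rightarrow> ('a \<Rightarrow> 'a) set" where
  "affine_diffeos_plus S =
     {T \<in> affine_diffeos S.
        \<forall>p\<in>topspace (regular_part S). \<forall>A. affine_at S T p A \<longrightarrow> det A > 0}"

text \<open>
  The matrix in \<^const>\<open>affine_at\<close> is unique and locally constant; hence, on a surface with
  connected nonempty regular part, exactly one matrix has the property below.
\<close>

definition differential :: "'a surface \<Rightarrow> ('a \<Rightarrow> 'a) \<Rightarrow> real^2^2" where
  "differential S T = (THE A. \<forall>p\<in>topspace (regular_part S). affine_at S T p A)"

definition veech_group :: "'a surface \<Rightarrow> (real^2^2) set" where
  "veech_group S = differential S ` affine_diffeos_plus S"


section \<open>The punctured plane and the superelliptic curve\<close>

definition punctured_plane :: "(nat \<Rightarrow> complex) \<Rightarrow> complex surface" where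
  "punctured_plane z =
     \<lparr>total = top_of_set (- range z), cone_points = {}, atlas = {(- range z, \<lambda>x. x)}\<rparr>"

definition superelliptic_curve :: "nat \<Rightarrow> (complex \<Rightarrow> complex) \<Rightarrow> (complex \<times> complex) set" where
  "superelliptic_curve n f = {(x, w). w ^ n = f x}"

definition superelliptic_surface ::
    "nat \<Rightarrow> (complex \<Rightarrow> complex) \<Rightarrow> (nat \<Rightarrow> complex) \<Rightarrow> (complex \<times> complex) surface" where
  "superelliptic_surface n f z =
     (let C = superelliptic_curve n f; \<Sigma> = range (\<lambda>k. (z k, 0)) in
      \<lparr>total = top_of_set C, cone_points = \<Sigma>,
       atlas = pullback_atlas (top_of_set (C - \<Sigma>)) fst
                 (total (punctured_plane z)) (atlas (punctured_plane z))\<rparr>)"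


section \<open>Basic properties\<close>

lemma closed_range_of_tendsto_infinity:
  fixes z :: "nat \<Rightarrow> complex"
  assumes "filterlim (\<lambda>k. norm (z k)) at_top sequentially"
  shows "closed (range z)"
proof -
  have fin: "finite {k. norm (z k) \<le> r}" for r
  proof -
    have "eventually (\<lambda>k. norm (z k) > r) sequentially"
      using assms by (simp add: filterlim_at_top_dense)
    then obtain N where "\<And>k. k \<ge> N \<Longrightarrow> norm (z k) > r"
      by (auto simp: eventually_sequentially)
    then have "{k. norm (z k) \<le> r} \<subseteq> {..<N}"
      by (force simp: not_le[symmetric])
    then show ?thesis
      using finite_subset by blast
  qed
  show ?thesis
    unfolding closed_limpt
  proof (intro allI impI)
    fix x assume "x islimpt range z"
    then have "infinite (range z \<inter> ball x 1)"
      by (simp add: islimpt_eq_infinite_ball)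
    moreover have "range z \<inter> ball x 1 \<subseteq> z ` {k. norm (z k) \<le> norm x + 1}"
    proof
      fix y assume y: "y \<in> range z \<inter> ball x 1"
      then have "norm y \<le> norm x + 1"
        using norm_triangle_ineq2[of y x] by (auto simp: dist_norm norm_minus_commute)
      with y show "y \<in> z ` {k. norm (z k) \<le> norm x + 1}"
        by auto
    qed
    ultimately show "x \<in> range z"
      using fin finite_subset by blast
  qed
qed

lemma weierstrass_map_eq_0_iff:
  assumes "weierstrass_map z f"
  shows "f x = 0 \<longleftrightarrow> x \<in> range z"
proof -
  from assms obtain h d where h: "\<And>x. h x \<noteq> 0"
    and c: "\<And>x. convergent_prod (\<lambda>k. weierstrass_term z d k x)"
    and f: "\<And>x. f x = h x * x ^ (if 0 \<in> range z then 1 else 0) * (\<Prod>k. weierstrass_term z d k x)"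
    unfolding weierstrass_map_def by blast
  have "(\<Prod>k. weierstrass_term z d k x) = 0 \<longleftrightarrow> (\<exists>k. weierstrass_term z d k x = 0)"
    using has_prod_eq_0_iff[OF convergent_prod_has_prod[OF c[of x]]] by auto
  also have "\<dots> \<longleftrightarrow> (\<exists>k. z k \<noteq> 0 \<and> x = z k)"
    by (auto simp: weierstrass_term_def)
  finally have P: "(\<Prod>k. weierstrass_term z d k x) = 0 \<longleftrightarrow> (\<exists>k. z k \<noteq> 0 \<and> x = z k)" .
  show ?thesis
  proof (cases "x = 0")
    case True
    then have "(\<Prod>k. weierstrass_term z d k x) \<noteq> 0"
      using P by metis
    with True show ?thesis
      using h[of x] unfolding f[of x] by auto
  next
    case False
    then have "(\<exists>k. z k \<noteq> 0 \<and> x = z k) \<longleftrightarrow> x \<in> range z"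
      by blast
    with False P show ?thesis
      using h[of x] unfolding f[of x] by simp
  qed
qed

lemma weierstrass_map_holomorphic:
  assumes "weierstrass_map z f"
  shows "f holomorphic_on UNIV"
proof -
  from assms obtain h d where h: "h holomorphic_on UNIV"
    and c: "\<And>x. convergent_prod (\<lambda>k. weierstrass_term z d k x)"
    and u: "\<And>K. compact K \<Longrightarrow> uniformly_convergent_on K (\<lambda>N x. \<Prod>k<N. weierstrass_term z d k x)"
    and f: "\<And>x. f x = h x * x ^ (if 0 \<in> range z then 1 else 0) * (\<Prod>k. weierstrass_term z d k x)"
    unfolding weierstrass_map_def by blast
  have "(\<lambda>x. \<Prod>k. weierstrass_term z d k x) holomorphic_on UNIV"
  proof (rule holomorphic_uniform_sequence)
    show "(\<lambda>x. \<Prod>k<N. weierstrass_term z d k x) holomorphic_on UNIV" for N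
    proof (intro holomorphic_intros)
      show "(\<lambda>x. weierstrass_term z d k x) holomorphic_on UNIV" for k
        by (cases "z k = 0") (auto simp: weierstrass_term_def intro!: holomorphic_intros)
    qed
    show "\<exists>e>0. cball x e \<subseteq> UNIV \<and> uniform_limit (cball x e)
            (\<lambda>N x. \<Prod>k<N. weierstrass_term z d k x) (\<lambda>x. \<Prod>k. weierstrass_term z d k x) sequentially"
      for x
    proof -
      have "lim (\<lambda>N. \<Prod>k<N. weierstrass_term z d k y) = (\<Prod>k. weierstrass_term z d k y)" for y
        using has_prod_imp_tendsto'[OF convergent_prod_has_prod[OF c[of y]]] by (rule limI)
      then have "uniform_limit (cball x 1) (\<lambda>N x. \<Prod>k<N. weierstrass_term z d k x)
                   (\<lambda>x. \<Prod>k. weierstrass_term z d k x) sequentially"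
        using u[of "cball x 1"] by (simp add: uniformly_convergent_uniform_limit_iff)
      then show ?thesis
        by (intro exI[of _ 1]) auto
    qed
  qed auto
  then have "(\<lambda>x. h x * x ^ (if 0 \<in> range z then 1 else 0) * (\<Prod>k. weierstrass_term z d k x))
               holomorphic_on UNIV"
    using h by (intro holomorphic_intros)
  then show ?thesis
    by (simp add: f[abs_def])
qed

lemma regular_part_punctured_plane [simp]:
  "regular_part (punctured_plane z) = top_of_set (- range z)"
  by (simp add: regular_part_def punctured_plane_def subtopology_subtopology)

lemma regular_part_superelliptic_surface [simp]:
  "regular_part (superelliptic_surface n f z) =
     top_of_set (superelliptic_curve n f - range (\<lambda>k. (z k, 0)))"
  by (simp add: regular_part_def superelliptic_surface_def Let_def subtopology_subtopology Int_absorb1 Diff_subset)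

lemma translation_surface_punctured_plane:
  assumes "filterlim (\<lambda>k. norm (z k)) at_top sequentially"
  shows "translation_surface (punctured_plane z)"
proof -
  have "open (- range z)"
    using closed_range_of_tendsto_infinity[OF assms] by auto
  then show ?thesis
    unfolding translation_surface_def translation_atlas_def regular_part_punctured_plane
    by (auto simp: punctured_plane_def Hausdorff_space_subtopology subtopology_subtopology
          homeomorphic_map_id[unfolded id_def] intro!: exI[of _ "- range z"])
qed

lemma homeomorphism_imp_homeomorphic_map:
  assumes "homeomorphism X Y g h"
  shows "homeomorphic_map (top_of_set X) (top_of_set Y) g"
proof -
  have "homeomorphic_maps (top_of_set X) (top_of_set Y) g h"
    using assms by (auto simp: homeomorphic_maps_def homeomorphism_def)
  then show ?thesis
    by (auto simp: homeomorphic_map_maps)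
qed

lemma translation_surface_superelliptic_surface:
  assumes lim: "filterlim (\<lambda>k. norm (z k)) at_top sequentially"
    and f: "weierstrass_map z f" and n: "n \<ge> 1"
  shows "translation_surface (superelliptic_surface n f z)"
proof -
  define C where "C = superelliptic_curve n f"
  define \<Sigma> where "\<Sigma> = range (\<lambda>k. (z k, 0 :: complex))"
  define R where "R = C - \<Sigma>"
  define \<A> where "\<A> = atlas (superelliptic_surface n f z)"
  have op: "open (- range z)"
    using closed_range_of_tendsto_infinity[OF lim] by auto
  note f0 = weierstrass_map_eq_0_iff[OF f]
  have cf: "continuous_on UNIV f"
    using weierstrass_map_holomorphic[OF f] holomorphic_on_imp_continuous_on by blast
  have R: "R = {(x, w). w ^ n = f x \<and> w \<noteq> 0}" "R = {(x, w). w ^ n = f x \<and> x \<notin> range z}"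
  proof -
    have "w = 0 \<longleftrightarrow> x \<in> range z" if "w ^ n = f x" for x w
    proof -
      have "w = 0 \<longleftrightarrow> w ^ n = 0"
        using n by simp
      with that f0[of x] show ?thesis by simp
    qed
    then show "R = {(x, w). w ^ n = f x \<and> w \<noteq> 0}" "R = {(x, w). w ^ n = f x \<and> x \<notin> range z}"
      unfolding R_def C_def \<Sigma>_def superelliptic_curve_def by blast+
  qed
  have \<Sigma>: "\<Sigma> \<subseteq> C"
    using n f0 by (auto simp: C_def \<Sigma>_def superelliptic_curve_def power_0_left)
  have A: "(U, \<phi>) \<in> \<A> \<longleftrightarrow> openin (top_of_set R) U \<and> open (fst ` U) \<and> \<phi> = fst \<and>
              fst ` U \<subseteq> - range z \<and> homeomorphic_map (top_of_set U) (top_of_set (fst ` U)) fst"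
    for U :: "(complex \<times> complex) set" and \<phi>
  proof -
    have 1: "openin (top_of_set (- range z)) (fst ` U) \<longleftrightarrow> open (fst ` U) \<and> fst ` U \<subseteq> - range z"
      by (rule openin_open_eq[OF op])
    have 2: "subtopology (top_of_set R) U = top_of_set U" if "openin (top_of_set R) U"
      using openin_imp_subset[OF that] by (simp add: subtopology_subtopology Int_absorb1)
    have 3: "subtopology (top_of_set (- range z)) (fst ` U) = top_of_set (fst ` U)"
      if "fst ` U \<subseteq> - range z"
      using that by (simp only: subtopology_subtopology Int_absorb1)
    have "\<A> = pullback_atlas (top_of_set R) fst (top_of_set (- range z)) {(- range z, \<lambda>x. x)}"
      by (simp add: \<A>_def superelliptic_surface_def Let_def punctured_plane_def R_def C_def \<Sigma>_def)
    then have "(U, \<phi>) \<in> \<A> \<longleftrightarrow> openin (top_of_set R) U \<and>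
        openin (top_of_set (- range z)) (fst ` U) \<and> \<phi> = fst \<and> fst ` U \<subseteq> - range z \<and>
        homeomorphic_map (subtopology (top_of_set R) U) (subtopology (top_of_set (- range z)) (fst ` U)) fst"
      by (simp add: pullback_atlas_def comp_def) blast
    then show ?thesis
      using 1 2 3 by metis
  qed
  have cover: "\<exists>U. p \<in> U \<and> (U, fst) \<in> \<A>" if p: "p \<in> R" for p
  proof -
    obtain x0 w0 where p': "p = (x0, w0)" "w0 ^ n = f x0" "w0 \<noteq> 0"
      using p R(1) by auto
    have "covering_space (- {0}) (\<lambda>w::complex. w ^ n) (- {0})"
      using n by (intro covering_space_power_punctured_plane) auto
    moreover have "f x0 \<in> - {0}"
      using p' n by (metis ComplI power_not_zero singletonD)
    ultimately obtain V v where V: "f x0 \<in> V" "openin (top_of_set (- {0})) V"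
      and v: "\<Union>v = - {0} \<inter> (\<lambda>w::complex. w ^ n) -` V"
      and v': "\<forall>u\<in>v. openin (top_of_set (- {0})) u"
      and vh: "\<forall>u\<in>v. \<exists>q. homeomorphism u V (\<lambda>w. w ^ n) q"
      unfolding covering_space_def by meson
    have "w0 \<in> \<Union>v"
      using V p' by (auto simp: v)
    then obtain u where u: "u \<in> v" "w0 \<in> u" by blast
    then obtain q where q: "homeomorphism u V (\<lambda>w. w ^ n) q"
      using vh by blast
    have ou: "open u" and u0: "0 \<notin> u"
      using v' u(1) openin_open_eq[of "- {0 :: complex}" u] by auto
    have oV: "open V" and V0: "0 \<notin> V"
      using V(2) openin_open_eq[of "- {0 :: complex}" V] by auto
    define U where "U = {(x, w). w ^ n = f x \<and> w \<in> u}"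
    have fU: "fst ` U = f -` V"
    proof
      show "fst ` U \<subseteq> f -` V"
        using homeomorphism_image1[OF q] by (force simp: U_def)
    next
      show "f -` V \<subseteq> fst ` U"
      proof
        fix x assume "x \<in> f -` V"
        then have "(x, q (f x)) \<in> U"
          using homeomorphism_image2[OF q] homeomorphism_apply2[OF q] by (auto simp: U_def)
        then show "x \<in> fst ` U" by force
      qed
    qed
    have "homeomorphism U (f -` V) fst (\<lambda>x. (x, q (f x)))"
    proof (rule homeomorphismI)
      have cq: "continuous_on V q"
        using q by (simp add: homeomorphism_def)
      show "continuous_on (f -` V) (\<lambda>x. (x, q (f x)))"
        by (intro continuous_intros continuous_on_compose2[OF cq]
              continuous_on_subset[OF cf]) auto
      show "fst ` U \<subseteq> f -` V" by (simp add: fU)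
      show "(\<lambda>x. (x, q (f x))) ` (f -` V) \<subseteq> U"
        using homeomorphism_image2[OF q] homeomorphism_apply2[OF q] by (auto simp: U_def)
      show "(fst y, q (f (fst y))) = y" if "y \<in> U" for y
        using that homeomorphism_apply1[OF q] by (force simp: U_def)
    qed (auto intro: continuous_intros)
    then have "homeomorphic_map (top_of_set U) (top_of_set (fst ` U)) fst"
      unfolding fU by (rule homeomorphism_imp_homeomorphic_map)
    moreover have "open (fst ` U)"
      using cf oV by (simp add: fU open_vimage)
    moreover have "openin (top_of_set R) U"
    proof -
      have "U = R \<inter> (UNIV \<times> u)"
        using u0 by (auto simp: U_def R(1))
      then show ?thesis
        using ou open_Times[of UNIV u] by (auto simp: openin_open)
    qed
    moreover have "fst ` U \<subseteq> - range z"
    proof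
      fix x assume "x \<in> fst ` U"
      then have "f x \<noteq> 0" using V0 by (auto simp: fU)
      then show "x \<in> - range z" using f0[of x] by simp
    qed
    moreover have "p \<in> U"
      using p' u by (simp add: U_def)
    ultimately show ?thesis
      using A by blast
  qed
  have cov: "(\<Union>(U, \<phi>)\<in>\<A>. U) = R"
  proof
    show "(\<Union>(U, \<phi>)\<in>\<A>. U) \<subseteq> R"
      using A openin_imp_subset by blast
    show "R \<subseteq> (\<Union>(U, \<phi>)\<in>\<A>. U)"
      using cover by blast
  qed
  moreover have "openin (top_of_set C) R"
  proof -
    have "R = C \<inter> ((- range z) \<times> UNIV)"
      by (auto simp: R(2) C_def superelliptic_curve_def)
    then show ?thesis
      using open_Times[OF op open_UNIV] by (auto simp: openin_open)
  qed
  moreover have trans: "\<exists>c W. openin (top_of_set R) W \<and> p \<in> W \<and> W \<subseteq> U \<inter> V \<and> (\<forall>q\<in>W. \<psi> q = \<phi> q + c)"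
    if "(U, \<phi>) \<in> \<A>" "(V, \<psi>) \<in> \<A>" "p \<in> U \<inter> V" for U V \<phi> \<psi> p
  proof (intro exI conjI)
    show "openin (top_of_set R) (U \<inter> V)"
      using that A by (blast intro: openin_Int)
    show "\<forall>q\<in>U \<inter> V. \<psi> q = \<phi> q + 0"
      using that A[of U \<phi>] A[of V \<psi>] by simp
  qed (use that in auto)
  moreover have ch: "openin (top_of_set R) U \<and> open (\<phi> ` U) \<and>
        homeomorphic_map (subtopology (top_of_set R) U) (top_of_set (\<phi> ` U)) \<phi>"
    if "(U, \<phi>) \<in> \<A>" for U \<phi>
  proof -
    have U: "openin (top_of_set R) U" "open (fst ` U)" "\<phi> = fst"
      "homeomorphic_map (top_of_set U) (top_of_set (fst ` U)) fst"
      using that A[of U \<phi>] by auto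
    moreover have "subtopology (top_of_set R) U = top_of_set U"
      using openin_imp_subset[OF U(1)] by (simp add: subtopology_subtopology Int_absorb1)
    ultimately show ?thesis by simp
  qed
  ultimately have "translation_atlas (top_of_set R) \<A>"
    unfolding translation_atlas_def topspace_euclidean_subtopology
  proof (intro conjI ballI, goal_cases)
    case 1
    show ?case by (rule cov)
  next
    case (2 c)
    then show ?case
      using ch[of "fst c" "snd c"] unfolding case_prod_beta by simp
  next
    case (3 c)
    show ?case
      unfolding case_prod_beta
    proof (intro ballI)
      fix c' p assume "c' \<in> \<A>" "p \<in> fst c \<inter> fst c'"
      with 3 show "\<exists>k W. openin (top_of_set R) W \<and> p \<in> W \<and> W \<subseteq> fst c \<inter> fst c' \<and>
                     (\<forall>q\<in>W. snd c' q = snd c q + k)"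
        using trans[of "fst c" "snd c" "fst c'" "snd c'" p] by simp
    qed
  qed
  moreover have "total (superelliptic_surface n f z) = top_of_set C"
    "cone_points (superelliptic_surface n f z) = \<Sigma>"
    by (simp_all add: superelliptic_surface_def Let_def C_def \<Sigma>_def)
  ultimately show ?thesis
    using \<open>openin (top_of_set C) R\<close> \<Sigma>
    by (simp add: translation_surface_def Hausdorff_space_subtopology \<A>_def
          flip: C_def \<Sigma>_def R_def)
qed

lemma mat_act_Complex:
  "A \<bullet>\<^sub>m x = Complex (A$1$1 * Re x + A$1$2 * Im x) (A$2$1 * Re x + A$2$2 * Im x)"
  by (simp add: mat_act_def matrix_vector_mult_def sum_2 Let_def)

lemma mat_act_add: "A \<bullet>\<^sub>m (x + y) = A \<bullet>\<^sub>m x + A \<bullet>\<^sub>m y"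
  by (simp add: mat_act_Complex complex_eq_iff algebra_simps)

lemma mat_act_diff: "A \<bullet>\<^sub>m (x - y) = A \<bullet>\<^sub>m x - A \<bullet>\<^sub>m y"
  by (simp add: mat_act_Complex complex_eq_iff algebra_simps)

lemma mat_act_scaleR: "A \<bullet>\<^sub>m (r *\<^sub>R x) = r *\<^sub>R (A \<bullet>\<^sub>m x)"
  by (simp add: mat_act_Complex complex_eq_iff algebra_simps)

lemma mat_act_mult: "A \<bullet>\<^sub>m (B \<bullet>\<^sub>m x) = (A ** B) \<bullet>\<^sub>m x"
  by (simp add: mat_act_Complex complex_eq_iff matrix_matrix_mult_def sum_2 algebra_simps)

lemma mat_act_one [simp]: "mat 1 \<bullet>\<^sub>m x = x"
  by (simp add: mat_act_Complex mat_def)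

lemma continuous_on_mat_act [continuous_intros]:
  "continuous_on X g \<Longrightarrow> continuous_on X (\<lambda>x. A \<bullet>\<^sub>m g x)"
  unfolding mat_act_Complex Complex_eq by (intro continuous_intros)

lemma affine_germ_unique:
  assumes "open W" "p \<in> W" and eq: "\<And>q. q \<in> W \<Longrightarrow> A \<bullet>\<^sub>m q + s = B \<bullet>\<^sub>m q + t"
  shows "A = B" "s = t"
proof -
  obtain e where e: "e > 0" "cball p e \<subseteq> W"
    using assms open_contains_cball by blast
  have v: "A \<bullet>\<^sub>m v = B \<bullet>\<^sub>m v" if "norm v \<le> 1" for v
  proof -
    have "p + e *\<^sub>R v \<in> W"
      using e that by (intro subsetD[OF e(2)]) (auto simp: dist_norm)
    then have "(A \<bullet>\<^sub>m (p + e *\<^sub>R v) + s) - (A \<bullet>\<^sub>m p + s) = (B \<bullet>\<^sub>m (p + e *\<^sub>R v) + t) - (B \<bullet>\<^sub>m p + t)"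
      using eq \<open>p \<in> W\<close> by simp
    then have "e *\<^sub>R (A \<bullet>\<^sub>m v) = e *\<^sub>R (B \<bullet>\<^sub>m v)"
      by (simp add: mat_act_add mat_act_scaleR)
    with e(1) show ?thesis by simp
  qed
  from v[of 1] v[of \<i>] show "A = B"
    by (simp add: mat_act_Complex vec_eq_iff forall_2)
  with eq[OF \<open>p \<in> W\<close>] show "s = t" by simp
qed

text \<open>
  The affine diffeomorphisms of the punctured plane are the restrictions of the
  affine maps of the plane that permute the punctures.
\<close>

lemma affine_at_punctured_plane:
  assumes "open (- range z)" "p \<notin> range z" "T p \<notin> range z"
  shows "affine_at (punctured_plane z) T p A \<longleftrightarrow>
           (\<exists>t W. open W \<and> p \<in> W \<and> W \<subseteq> - range z \<and>
              (\<forall>q\<in>W. T q \<notin> range z \<and> T q = A \<bullet>\<^sub>m q + t))"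
  using assms(2,3) openin_open_eq[OF assms(1)]
  by (simp add: affine_at_def) (auto simp: punctured_plane_def)

lemma affine_diffeos_plus_punctured_plane_iff:
  assumes lim: "filterlim (\<lambda>k. norm (z k)) at_top sequentially"
  shows "T \<in> affine_diffeos_plus (punctured_plane z) \<longleftrightarrow>
           (\<exists>A t. det A > 0 \<and> (\<lambda>x. A \<bullet>\<^sub>m x + t) ` range z = range z \<and>
                  (\<forall>x. x \<notin> range z \<longrightarrow> T x = A \<bullet>\<^sub>m x + t))"
proof -
  define P where "P = - range z"
  have op: "open P"
    using closed_range_of_tendsto_infinity[OF lim] by (auto simp: P_def)
  have "path_connected P"
    unfolding P_def by (rule path_connected_complement_countable) auto
  then have conn: "connected P"
    by (rule path_connected_imp_connected)
  have "P \<noteq> {}"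
  proof
    assume "P = {}"
    then have "range z = UNIV" by (auto simp: P_def)
    then have "countable (UNIV :: complex set)"
      by (metis countable_image uncountable_def)
    then show False
      using uncountable_UNIV_complex by simp
  qed
  have tot: "total (punctured_plane z) = top_of_set P" "cone_points (punctured_plane z) = {}"
    "regular_part (punctured_plane z) = top_of_set P"
    by (simp_all add: punctured_plane_def regular_part_def P_def subtopology_subtopology)
  have aff: "affine_at (punctured_plane z) T p A \<longleftrightarrow>
           (\<exists>t W. open W \<and> p \<in> W \<and> W \<subseteq> P \<and> (\<forall>q\<in>W. T q \<in> P \<and> T q = A \<bullet>\<^sub>m q + t))"
    if "p \<in> P" "T p \<in> P" for p A
    using affine_at_punctured_plane[of z p T A] that op by (simp add: P_def)
  have bij: "bij (\<lambda>x. A \<bullet>\<^sub>m x + t)" if "det A \<noteq> 0" for A :: "real^2^2" and t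
  proof -
    obtain B where B: "A ** B = mat 1" "B ** A = mat 1"
      using \<open>det A \<noteq> 0\<close> by (metis invertible_def invertible_det_nz)
    show ?thesis
      by (rule o_bij[of "\<lambda>y. B \<bullet>\<^sub>m (y - t)"]) (auto simp: fun_eq_iff mat_act_mult B)
  qed
  show ?thesis
  proof
    assume T: "T \<in> affine_diffeos_plus (punctured_plane z)"
    then have "homeomorphic_map (top_of_set P) (top_of_set P) T"
      by (simp add: affine_diffeos_plus_def affine_diffeos_def tot P_def)
    then have TP: "T ` P = P"
      using homeomorphic_imp_surjective_map by fastforce
    have "\<exists>A t W. open W \<and> p \<in> W \<and> W \<subseteq> P \<and> det A > 0 \<and> (\<forall>q\<in>W. T q = A \<bullet>\<^sub>m q + t)"
      if p: "p \<in> P" for p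
    proof -
      obtain A where A: "affine_at (punctured_plane z) T p A"
        using T p unfolding affine_diffeos_plus_def affine_diffeos_def tot topspace_euclidean_subtopology
        by blast
      then have "det A > 0"
        using T p unfolding affine_diffeos_plus_def tot topspace_euclidean_subtopology by blast
      with A aff[of p A] p TP show ?thesis by blast
    qed
    then obtain A t W where W: "\<And>p. p \<in> P \<Longrightarrow> open (W p)" "\<And>p. p \<in> P \<Longrightarrow> p \<in> W p"
        "\<And>p. p \<in> P \<Longrightarrow> W p \<subseteq> P" "\<And>p. p \<in> P \<Longrightarrow> det (A p) > 0"
        "\<And>p q. p \<in> P \<Longrightarrow> q \<in> W p \<Longrightarrow> T q = A p \<bullet>\<^sub>m q + t p"
      by metis
    have "(\<lambda>p. (A p, t p)) constant_on P"
    proof (rule locally_constant_imp_constant[OF conn])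
      fix a assume a: "a \<in> P"
      have "(A b, t b) = (A a, t a)" if b: "b \<in> W a" for b
      proof -
        have bP: "b \<in> P" using W(3) a b by blast
        have eq: "A b \<bullet>\<^sub>m q + t b = A a \<bullet>\<^sub>m q + t a" if "q \<in> W a \<inter> W b" for q
          using W(5)[OF a, of q] W(5)[OF bP, of q] that by simp
        have "open (W a \<inter> W b)" "b \<in> W a \<inter> W b"
          using W a b bP by auto
        from affine_germ_unique[OF this eq] show ?thesis by simp
      qed
      then show "\<exists>V. openin (top_of_set P) V \<and> a \<in> V \<and> (\<forall>x\<in>V. (A x, t x) = (A a, t a))"
        using W a openin_open_eq[OF op] by blast
    qed
    then obtain B s where B: "\<And>p. p \<in> P \<Longrightarrow> A p = B \<and> t p = s"
      unfolding constant_on_def by (metis prod.inject surj_pair)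
    have TB: "T p = B \<bullet>\<^sub>m p + s" if "p \<in> P" for p
      using W(5)[OF that W(2)[OF that]] B[OF that] by simp
    have dB: "det B > 0"
      using \<open>P \<noteq> {}\<close> W(4) B by (metis ex_in_conv)
    have "(\<lambda>x. B \<bullet>\<^sub>m x + s) ` P = P"
      using TP TB by (metis (no_types, lifting) image_cong)
    then have "(\<lambda>x. B \<bullet>\<^sub>m x + s) ` (- P) = - P"
      using bij_image_Compl_eq[OF bij[of B s], of P] dB by simp
    then show "\<exists>A t. det A > 0 \<and> (\<lambda>x. A \<bullet>\<^sub>m x + t) ` range z = range z \<and>
                  (\<forall>x. x \<notin> range z \<longrightarrow> T x = A \<bullet>\<^sub>m x + t)"
      using dB TB by (intro exI[of _ B] exI[of _ s]) (simp add: P_def)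
  next
    assume "\<exists>A t. det A > 0 \<and> (\<lambda>x. A \<bullet>\<^sub>m x + t) ` range z = range z \<and>
                  (\<forall>x. x \<notin> range z \<longrightarrow> T x = A \<bullet>\<^sub>m x + t)"
    then obtain A t where A: "det A > 0" and im: "(\<lambda>x. A \<bullet>\<^sub>m x + t) ` range z = range z"
      and TA: "\<And>x. x \<in> P \<Longrightarrow> T x = A \<bullet>\<^sub>m x + t"
      by (auto simp: P_def)
    obtain B where B: "A ** B = mat 1" "B ** A = mat 1"
      using A by (metis invertible_def invertible_det_nz less_irrefl)
    have "(\<lambda>x. A \<bullet>\<^sub>m x + t) ` P = P"
      using bij_image_Compl_eq[OF bij[of A t], of "range z"] A im by (simp add: P_def)
    then have TP: "T ` P = P"
      using TA by (metis (no_types, lifting) image_cong)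
    have "homeomorphism P P T (\<lambda>y. B \<bullet>\<^sub>m (y - t))"
    proof (rule homeomorphismI)
      have "continuous_on P (\<lambda>x. A \<bullet>\<^sub>m x + t)"
        by (intro continuous_intros)
      then show "continuous_on P T"
        by (rule continuous_on_eq) (simp add: TA)
      show inv: "B \<bullet>\<^sub>m (T x - t) = x" if "x \<in> P" for x
        using that by (simp add: TA mat_act_mult B)
      have "B \<bullet>\<^sub>m (y - t) \<in> P \<and> T (B \<bullet>\<^sub>m (y - t)) = y" if "y \<in> P" for y
      proof -
        obtain x where "x \<in> P" "y = T x"
          using TP \<open>y \<in> P\<close> by blast
        then show ?thesis
          using inv[of x] by simp
      qed
      then show "(\<lambda>y. B \<bullet>\<^sub>m (y - t)) ` P \<subseteq> P" "\<And>y. y \<in> P \<Longrightarrow> T (B \<bullet>\<^sub>m (y - t)) = y"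
        by blast+
    qed (use TP in \<open>auto intro!: continuous_intros\<close>)
    then have hom: "homeomorphic_map (top_of_set P) (top_of_set P) T"
      by (rule homeomorphism_imp_homeomorphic_map)
    have af: "affine_at (punctured_plane z) T p A" if "p \<in> P" for p
    proof -
      have "T p \<in> P" using that TP by blast
      moreover have "\<forall>q\<in>P. T q \<in> P \<and> T q = A \<bullet>\<^sub>m q + t"
        using TA TP by blast
      ultimately show ?thesis
        using aff[of p A] that op by blast
    qed
    have uniq: "C = A" if p: "p \<in> P" and C: "affine_at (punctured_plane z) T p C" for p C
    proof -
      have "T p \<in> P" using p TP by blast
      with p C aff[of p C] obtain s W where W: "open W" "p \<in> W" "W \<subseteq> P"
        "\<And>q. q \<in> W \<Longrightarrow> T q = C \<bullet>\<^sub>m q + s" by blast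
      show ?thesis
        by (rule affine_germ_unique(1)[OF W(1,2), of C s A t])
           (use W(3,4) TA in \<open>metis subsetD\<close>)
    qed
    have "invertible A"
      using A by (simp add: invertible_det_nz)
    with hom af uniq A show "T \<in> affine_diffeos_plus (punctured_plane z)"
      by (auto simp: affine_diffeos_plus_def affine_diffeos_def tot P_def)
  qed
qed

end

theory Submission
  imports Defs
begin

text \<open>
  Both groups consist of the matrices \<open>A\<close> of positive determinant for which some map \<open>G x = A x + t\<close>
  permutes the \<open>z k\<close>. For the superelliptic curve: its regular part is connected, so the first coordinate
  of an affine diffeomorphism is globally of the form \<open>G x\<close>. Conversely, \<open>G\<close> lifts to
  \<open>(x, w) \<mapsto> (G x, \<mu> x w)\<close> once \<open>\<mu>\<close> is a continuous \<open>n\<close>-th root of \<open>f (G x) / f x\<close>. Such a root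
  exists because \<open>G\<close> preserves orientation and \<open>f\<close> has simple zeros, so that \<open>f (G x)\<close> and \<open>f x\<close>
  both wind once around every \<open>z k\<close>.
\<close>

section \<open>Simplicity of the zeros of a Weierstrass map\<close>

text \<open>Isolates the one vanishing factor of a product: the other summand of the product rule
  drops out.\<close>

lemma deriv_mult_at_zero:
  fixes p q :: "complex \<Rightarrow> complex"
  assumes "p field_differentiable at a" "q field_differentiable at a" "p a = 0"
  shows "deriv (\<lambda>x. p x * q x) a = deriv p a * q a"
  using assms by simp

text \<open>The linear factor contributes \<open>- 1 / z k\<close> and the remaining factor is an
  exponential.\<close>

lemma deriv_weierstrass_term_nonzero:
  assumes "z k \<noteq> 0"
  shows "deriv (weierstrass_term z d k) (z k) \<noteq> 0"
proof -
  define q where "q = (\<lambda>x. exp (\<Sum>j=1..d k. (x / z k) ^ j / of_nat j))"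
  have "q field_differentiable at (z k)"
    unfolding q_def
    by (intro holomorphic_on_imp_differentiable_at[of _ UNIV] holomorphic_intros) (use assms in auto)
  moreover have "((\<lambda>x. 1 - x / z k) has_field_derivative - 1 / z k) (at (z k))"
    using assms by (auto intro!: derivative_eq_intros)
  moreover have "weierstrass_term z d k = (\<lambda>x. (1 - x / z k) * q x)"
    using assms by (simp add: fun_eq_iff weierstrass_term_def weierstrass_factor_def q_def)
  ultimately have "deriv (weierstrass_term z d k) (z k) = - 1 / z k * q (z k)"
    using deriv_mult_at_zero[of "\<lambda>x. 1 - x / z k" "z k" q] assms
    by (simp add: DERIV_imp_deriv[of "\<lambda>x. 1 - x / z k"] field_differentiable_def[of "\<lambda>x. 1 - x / z k"] exI)
  then show ?thesis
    using assms by (simp add: q_def)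
qed

text \<open>Exactly one factor of \<open>f\<close> vanishes at \<open>z k\<close>: the power of
  \<open>x\<close> if \<open>z k = 0\<close>, otherwise, by injectivity, the \<open>k\<close>-th
  term of the product. Its zero is simple, and a convergent product of nonzero factors is
  nonzero.\<close>

lemma weierstrass_map_deriv_nonzero:
  assumes "inj z" "weierstrass_map z f"
  shows "deriv f (z k) \<noteq> 0"
proof -
  from assms obtain h d where h: "h holomorphic_on UNIV" "\<And>x. h x \<noteq> 0"
    and c: "\<And>x. convergent_prod (\<lambda>k. weierstrass_term z d k x)"
    and u: "\<And>K. compact K \<Longrightarrow> uniformly_convergent_on K (\<lambda>N x. \<Prod>k<N. weierstrass_term z d k x)"
    and f: "\<And>x. f x = h x * x ^ (if 0 \<in> range z then 1 else 0) * (\<Prod>k. weierstrass_term z d k x)"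
    unfolding weierstrass_map_def by blast
  define t where "t = weierstrass_term z d"
  define P where "P = (\<lambda>x. \<Prod>k. t k x)"
  have t0: "t j x = 0 \<longleftrightarrow> z j \<noteq> 0 \<and> x = z j" for j x
    by (auto simp: t_def weierstrass_term_def)
  have t_holo: "t j holomorphic_on UNIV" for j
    by (cases "z j = 0") (auto simp: t_def weierstrass_term_def[abs_def] intro!: holomorphic_intros)
  have "lim (\<lambda>N. \<Prod>k<N. t k y) = P y" for y
    using has_prod_imp_tendsto'[OF convergent_prod_has_prod[OF c[of y]]]
    unfolding t_def P_def by (rule limI)
  then have ul: "uniform_limit K (\<lambda>N x. \<Prod>k<N. t k x) P sequentially" if "compact K" for K
    using u[OF that] by (simp add: uniformly_convergent_uniform_limit_iff t_def)
  \<comment> \<open>Locally uniform limits of holomorphic functions commute with differentiation, so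
    \<open>deriv P\<close> can be computed from the partial products.\<close>
  have P_lim: "(\<lambda>N. deriv (\<lambda>x. \<Prod>j<N. t j x) x) \<longlonglongrightarrow> deriv P x" for x
  proof (rule deriv_complex_uniform_limit)
    show "uniform_limit (ball x 1) (\<lambda>N x. \<Prod>k<N. t k x) P sequentially"
      using ul[of "cball x 1"] by (rule uniform_limit_on_subset) auto
    show "\<forall>\<^sub>F N in sequentially. (\<lambda>x. \<Prod>j<N. t j x) holomorphic_on ball x 1"
      by (intro always_eventually allI holomorphic_intros holomorphic_on_subset[OF t_holo]) auto
  qed auto
  have P_holo: "P holomorphic_on UNIV"
  proof (rule holomorphic_uniform_sequence)
    show "(\<lambda>x. \<Prod>j<N. t j x) holomorphic_on UNIV" for N
      by (intro holomorphic_intros t_holo)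
    show "\<exists>e>0. cball x e \<subseteq> UNIV \<and> uniform_limit (cball x e) (\<lambda>N x. \<Prod>k<N. t k x) P sequentially" for x
      using ul[of "cball x 1"] by (intro exI[of _ 1]) auto
  qed auto
  have fd: "g field_differentiable at x" if "g holomorphic_on UNIV" for g :: "complex \<Rightarrow> complex" and x
    using that by (simp add: holomorphic_on_imp_differentiable_at)
  show ?thesis
  proof (cases "z k = 0")
    case True
    then have "0 \<in> range z" by (metis rangeI)
    then have feq: "f = (\<lambda>x. x * (h x * P x))"
      using f by (simp add: fun_eq_iff P_def t_def)
    have "(\<lambda>x. h x * P x) holomorphic_on UNIV"
      using h P_holo by (intro holomorphic_intros)
    from deriv_mult_at_zero[of "\<lambda>x. x" 0, OF _ fd[OF this]]
    have "deriv f 0 = h 0 * P 0"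
      unfolding feq by simp
    moreover have "P 0 \<noteq> 0"
      unfolding P_def using prodinf_nonzero[OF c[of 0]] t0 unfolding t_def by metis
    ultimately show ?thesis
      using h True by simp
  next
    case False
    \<comment> \<open>The factor vanishing at \<open>z k\<close> is replaced by 1, so that
      \<open>prodinf s\<close> is the product of all the others.\<close>
    define s where "s = (\<lambda>j. if j = k then 1 else t j (z k))"
    \<comment> \<open>The shift by \<open>Suc k\<close> skips the altered index; beyond it
      \<open>s\<close> agrees with the original factors.\<close>
    have "convergent_prod (\<lambda>j. s (j + Suc k))"
      using c[of "z k"] convergent_prod_iff_shift[of "\<lambda>j. t j (z k)" "Suc k"]
      by (simp add: s_def t_def)
    then have s: "convergent_prod s"
      by (simp only: convergent_prod_iff_shift)
    have "s j \<noteq> 0" for j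
      using assms(1) t0 by (auto simp: s_def inj_eq)
    then have s0: "prodinf s \<noteq> 0"
      using prodinf_nonzero[OF s] by blast
    have "(\<lambda>N. deriv (t k) (z k) * (\<Prod>j<N. s j)) \<longlonglongrightarrow> deriv (t k) (z k) * prodinf s"
      by (intro tendsto_intros has_prod_imp_tendsto' convergent_prod_has_prod s)
    then have "(\<lambda>N. deriv (\<lambda>x. \<Prod>j<N. t j x) (z k)) \<longlonglongrightarrow> deriv (t k) (z k) * prodinf s"
    proof (rule Lim_transform_eventually)
      show "\<forall>\<^sub>F N in sequentially.
          deriv (t k) (z k) * (\<Prod>j<N. s j) = deriv (\<lambda>x. \<Prod>j<N. t j x) (z k)"
        using eventually_gt_at_top[of k]
      proof eventually_elim
        case (elim N)
        have "(\<lambda>x. \<Prod>j<N. t j x) = (\<lambda>x. t k x * (\<Prod>j\<in>{..<N}-{k}. t j x))"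
          using elim by (simp add: fun_eq_iff prod.remove)
        moreover have "(\<lambda>x. \<Prod>j\<in>{..<N}-{k}. t j x) holomorphic_on UNIV"
          by (intro holomorphic_intros t_holo)
        ultimately have "deriv (\<lambda>x. \<Prod>j<N. t j x) (z k) =
            deriv (t k) (z k) * (\<Prod>j\<in>{..<N}-{k}. t j (z k))"
          using deriv_mult_at_zero[OF fd[OF t_holo] fd] t0 False by simp
        also have "(\<Prod>j\<in>{..<N}-{k}. t j (z k)) = (\<Prod>j<N. s j)"
          using elim by (subst prod.remove[of "{..<N}" k s]) (auto simp: s_def intro!: prod.cong)
        finally show ?case by simp
      qed
    qed
    then have "deriv P (z k) = deriv (t k) (z k) * prodinf s"
      by (rule LIMSEQ_unique[OF P_lim])
    then have P': "deriv P (z k) \<noteq> 0"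
      using s0 deriv_weierstrass_term_nonzero[of z k, OF False] by (simp add: t_def)
    have "t k (z k) = 0" using t0 False by simp
    then have "P (z k) = 0"
      unfolding P_def using has_prod_eq_0_iff[OF convergent_prod_has_prod[OF c[of "z k"]]]
      by (auto simp: t_def)
    moreover define g where "g = (\<lambda>x. h x * x ^ (if 0 \<in> range z then 1 else 0))"
    moreover have "g holomorphic_on UNIV"
      unfolding g_def using h by (intro holomorphic_intros)
    moreover have "f = (\<lambda>x. P x * g x)"
      using f by (simp add: fun_eq_iff P_def t_def g_def)
    ultimately have "deriv f (z k) = deriv P (z k) * g (z k)"
      using deriv_mult_at_zero[OF fd[OF P_holo] fd] by simp
    then show ?thesis
      using P' h(2) False by (simp add: g_def)
  qed
qed

section \<open>Continuous roots of the quotient of \<open>f\<close> after and before an affine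
  map\<close>

text \<open>Splits a real-linear map into its complex-linear and antilinear parts. Preserving
  orientation then means \<open>norm \<beta> < norm \<alpha>\<close>.\<close>

lemma mat_act_conv_cnj:
  obtains \<alpha> \<beta> where "\<And>x. A \<bullet>\<^sub>m x = \<alpha> * x + \<beta> * cnj x" "det A = (norm \<alpha>)\<^sup>2 - (norm \<beta>)\<^sup>2"
proof
  \<comment> \<open>The Wirtinger derivatives, recovered from the images of 1 and
    \<open>\<i>\<close>.\<close>
  define \<alpha> where "\<alpha> = (A \<bullet>\<^sub>m 1 - \<i> * (A \<bullet>\<^sub>m \<i>)) / 2"
  define \<beta> where "\<beta> = (A \<bullet>\<^sub>m 1 + \<i> * (A \<bullet>\<^sub>m \<i>)) / 2"
  show "A \<bullet>\<^sub>m x = \<alpha> * x + \<beta> * cnj x" for x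
    by (simp add: mat_act_Complex complex_eq_iff \<alpha>_def \<beta>_def field_simps)
  show "det A = (norm \<alpha>)\<^sup>2 - (norm \<beta>)\<^sup>2"
    unfolding cmod_power2 det_2 \<alpha>_def \<beta>_def
    by (simp add: mat_act_Complex power2_eq_square field_simps)
qed

lemma nth_root_of_affine_quotient:
  fixes f :: "complex \<Rightarrow> complex"
  assumes f: "f holomorphic_on UNIV" and f': "\<And>x. f x = 0 \<Longrightarrow> deriv f x \<noteq> 0"
    and \<alpha>\<beta>: "norm \<beta> < norm \<alpha>"
    and G: "\<And>x. f (\<alpha> * x + \<beta> * cnj x + t) = 0 \<longleftrightarrow> f x = 0"
    and n: "n > 0"
  obtains \<mu> where "continuous_on {x. f x \<noteq> 0} \<mu>" "\<And>x. \<mu> x \<noteq> 0"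
    "\<And>x. f x \<noteq> 0 \<Longrightarrow> \<mu> x ^ n * f x = f (\<alpha> * x + \<beta> * cnj x + t)"
proof -
  txt \<open>
    Near a zero \<open>a\<close> of \<open>f\<close>, with \<open>u = x - a\<close>, the numerator \<open>f (G x)\<close> behaves like
    \<open>f'(G a) (\<alpha> u + \<beta> cnj u)\<close>. The function \<open>H\<close> imitates the last factor by means of \<open>f\<close> alone:
    at \<open>a\<close> it behaves like \<open>f'(a) (\<alpha> u + \<beta> cnj u)\<close>, while \<open>H / f\<close> stays in a disc around \<open>\<alpha>\<close>
    that avoids 0. Hence \<open>f (G x) / H x\<close> extends to a zero-free continuous function on the plane,
    which has a logarithm. The summand \<open>(norm (f x))\<^sup>2\<close> in \<open>\<kappa>\<close> only keeps the denominator nonzero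
    at critical points.
  \<close>
  define G where "G = (\<lambda>x. \<alpha> * x + \<beta> * cnj x + t)"
  define \<kappa> where "\<kappa> = (\<lambda>x. (deriv f x)\<^sup>2 / of_real ((norm (deriv f x))\<^sup>2 + (norm (f x))\<^sup>2))"
  define H where "H = (\<lambda>x. \<alpha> * f x + \<beta> * cnj (f x) * \<kappa> x)"
  have G0: "f (G x) = 0 \<longleftrightarrow> f x = 0" for x
    using G by (simp add: G_def)
  have \<alpha>0: "\<alpha> \<noteq> 0" using \<alpha>\<beta> by auto
  have contf: "isCont f x" for x
    using holomorphic_on_imp_continuous_on[OF f] by (simp add: continuous_on_eq_continuous_at)
  have contf': "isCont (deriv f) x" for x
    using holomorphic_on_imp_continuous_on[OF holomorphic_deriv[OF f]] by (simp add: continuous_on_eq_continuous_at)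
  have contG: "isCont G x" for x
    unfolding G_def by (intro continuous_intros)
  have den: "(norm (deriv f x))\<^sup>2 + (norm (f x))\<^sup>2 \<noteq> 0" for x
    using f'[of x] by (auto simp: add_nonneg_eq_0_iff)
  have cont\<kappa>: "isCont \<kappa> x" for x
    unfolding \<kappa>_def using den[of x] contf[of x] contf'[of x] of_real_eq_0_iff
    by (intro continuous_intros) (auto simp del: of_real_add)
  have norm\<kappa>: "norm (\<kappa> x) \<le> 1" for x
    using den[of x] unfolding \<kappa>_def norm_divide norm_power norm_of_real
    by (simp add: divide_le_eq) (smt (verit) zero_le_power2)
  have contH: "isCont H x" for x
    unfolding H_def by (intro continuous_intros contf cont\<kappa>)
  \<comment> \<open>Off the zeros of \<open>f\<close> this is \<open>H / (\<alpha> * f)\<close>. It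
    lies in the right half-plane, where the principal logarithm is continuous.\<close>
  define \<rho> where "\<rho> = (\<lambda>x. 1 + \<beta> / \<alpha> * (cnj (f x) / f x * \<kappa> x))"
  have H\<rho>: "H x = \<alpha> * f x * \<rho> x" if "f x \<noteq> 0" for x
    using that \<alpha>0 by (simp add: H_def \<rho>_def field_simps)
  have Re\<rho>: "Re (\<rho> x) > 0" if "f x \<noteq> 0" for x
  proof -
    have "norm (\<beta> / \<alpha> * (cnj (f x) / f x * \<kappa> x)) = norm \<beta> / norm \<alpha> * norm (\<kappa> x)"
      using that by (simp add: norm_mult norm_divide)
    also have "\<dots> \<le> norm \<beta> / norm \<alpha>"
      using norm\<kappa> by (intro mult_left_le) auto
    also have "\<dots> < 1" using \<alpha>\<beta> \<alpha>0 by (simp add: divide_less_eq)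
    finally show ?thesis
      using abs_Re_le_cmod[of "\<beta> / \<alpha> * (cnj (f x) / f x * \<kappa> x)"] by (simp add: \<rho>_def)
  qed
  have H0: "H x \<noteq> 0" if "f x \<noteq> 0" for x
    using H\<rho>[OF that] that Re\<rho>[OF that] \<alpha>0 by auto
  \<comment> \<open>The value at a zero of \<open>f\<close> is forced by the limit: numerator and
    denominator share the factor \<alpha> u + \<beta> cnj u to first order, and the derivatives
    remain.\<close>
  define Q where "Q = (\<lambda>x. if f x = 0 then deriv f (G x) / deriv f x else f (G x) / H x)"
  have Q0: "Q x \<noteq> 0" for x
    using f'[of x] f'[of "G x"] G0[of x] H0[of x] by (auto simp: Q_def)
  have nz: "\<forall>\<^sub>F x in at a. f x \<noteq> 0" for a
  proof (cases "f a = 0")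
    case False
    then show ?thesis
      using contf[of a] by (simp add: isCont_def tendsto_imp_eventually_ne)
  next
    case True
    have "(f has_field_derivative deriv f a) (at a)"
      using f by (simp add: holomorphic_derivI)
    then have "((\<lambda>x. (f x - f a) / (x - a)) \<longlongrightarrow> deriv f a) (at a)"
      by (simp add: has_field_derivative_iff)
    from tendsto_imp_eventually_ne[OF this f'[OF True]] show ?thesis
      by eventually_elim (use True in auto)
  qed
  have "isCont Q a" for a
  proof (cases "f a = 0")
    case False
    then have "((\<lambda>x. f (G x) / H x) \<longlongrightarrow> f (G a) / H a) (at a)"
      using H0[of a] contH[of a] contf[of "G a"] contG[of a]
      by (intro tendsto_intros) (auto simp: isCont_def intro: isCont_tendsto_compose[OF contf])
    moreover have "\<forall>\<^sub>F x in at a. f (G x) / H x = Q x"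
      using nz[of a] by eventually_elim (simp add: Q_def)
    ultimately have "(Q \<longlongrightarrow> f (G a) / H a) (at a)"
      using tendsto_cong by force
    then show ?thesis
      using False by (simp add: isCont_def Q_def)
  next
    case True
    define l where "l = (\<lambda>x. \<alpha> * (x - a) + \<beta> * cnj (x - a))"
    \<comment> \<open>This lower bound, positive for \<open>x \<noteq> a\<close> because
      \<open>norm \<beta> < norm \<alpha>\<close>, permits division by \<open>l x\<close> and shows
      \<open>G x \<noteq> G a\<close>.\<close>
    have l_ge: "(norm \<alpha> - norm \<beta>) * norm (x - a) \<le> norm (l x)" for x
      using norm_diff_ineq[of "\<alpha> * (x - a)" "\<beta> * cnj (x - a)"]
      unfolding norm_mult complex_mod_cnj by (simp add: l_def algebra_simps)
    have l0: "l x \<noteq> 0" if "x \<noteq> a" for x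
      using l_ge[of x] \<alpha>\<beta> that
      by (smt (verit) mult_pos_pos norm_eq_zero right_minus_eq zero_less_norm_iff)
    have Gl: "G x - G a = l x" for x
      by (simp add: G_def l_def algebra_simps)
    have D: "((\<lambda>x. (f x - f b) / (x - b)) \<longlongrightarrow> deriv f b) (at b)" for b
      using f holomorphic_derivI[of f UNIV b] by (simp add: has_field_derivative_iff)
    have "filterlim G (at (G a)) (at a)"
      unfolding filterlim_at
    proof
      show "\<forall>\<^sub>F x in at a. G x \<in> UNIV \<and> G x \<noteq> G a"
        using eventually_neq_at_within[of a a UNIV]
        by eventually_elim (metis Gl l0 UNIV_I right_minus_eq)
      show "(G \<longlongrightarrow> G a) (at a)" using contG by (simp add: isCont_def)
    qed
    from filterlim_compose[OF D this]
    have 1: "((\<lambda>x. f (G x) / l x) \<longlongrightarrow> deriv f (G a)) (at a)"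
      using True G0[of a] by (simp add: Gl)
    define q where "q = (\<lambda>x. f x / (x - a))"
    have q: "(q \<longlongrightarrow> deriv f a) (at a)"
      using D[of a] True by (simp add: q_def)
    \<comment> \<open>At a zero of \<open>f\<close> the factor \<open>\<kappa>\<close> turns the
      conjugate of the derivative back into the derivative, so \<open>H\<close> is
      \<open>deriv f a * l\<close> to first order.\<close>
    have "\<kappa> a = deriv f a / cnj (deriv f a)"
    proof -
      have "complex_of_real ((norm (deriv f a))\<^sup>2 + (norm (f a))\<^sup>2) = deriv f a * cnj (deriv f a)"
        using True complex_norm_square[of "deriv f a"] by simp
      then show ?thesis
        using f'[OF True] by (simp add: \<kappa>_def power2_eq_square del: of_real_add)
    qed
    then have \<kappa>a: "cnj (deriv f a) * \<kappa> a = deriv f a"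
      using f'[OF True] by simp
    \<comment> \<open>Bounds the error of \<open>H / l\<close> against \<open>deriv f a\<close>; the
      divisor comes from \<open>l_ge\<close>.\<close>
    define e where "e = (\<lambda>x. (norm \<alpha> * norm (q x - deriv f a) +
        norm \<beta> * norm (cnj (q x) * \<kappa> x - deriv f a)) / (norm \<alpha> - norm \<beta>))"
    have "(e \<longlongrightarrow> (norm \<alpha> * norm (deriv f a - deriv f a) +
        norm \<beta> * norm (cnj (deriv f a) * \<kappa> a - deriv f a)) / (norm \<alpha> - norm \<beta>)) (at a)"
      unfolding e_def using \<alpha>\<beta> cont\<kappa>[of a] q by (intro tendsto_intros) (auto simp: isCont_def)
    then have e: "(e \<longlongrightarrow> 0) (at a)"
      by (simp add: \<kappa>a)
    have "((\<lambda>x. H x / l x - deriv f a) \<longlongrightarrow> 0) (at a)"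
    proof (rule Lim_null_comparison[OF _ e])
      show "\<forall>\<^sub>F x in at a. norm (H x / l x - deriv f a) \<le> e x"
        using eventually_neq_at_within[of a a UNIV]
      proof eventually_elim
        case (elim x)
        have fx: "f x = q x * (x - a)" using elim by (simp add: q_def)
        have "H x / l x - deriv f a = (H x - l x * deriv f a) / l x"
          using l0[OF elim] by (simp add: field_simps)
        also have "H x - l x * deriv f a = \<alpha> * (x - a) * (q x - deriv f a) +
             \<beta> * cnj (x - a) * (cnj (q x) * \<kappa> x - deriv f a)"
          by (simp add: H_def l_def fx algebra_simps)
        finally have "norm (H x / l x - deriv f a) = norm (\<alpha> * (x - a) * (q x - deriv f a) +
             \<beta> * cnj (x - a) * (cnj (q x) * \<kappa> x - deriv f a)) / norm (l x)"
          by (simp add: norm_divide)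
        also have "\<dots> \<le> (norm \<alpha> * norm (q x - deriv f a) + norm \<beta> * norm (cnj (q x) * \<kappa> x - deriv f a))
            * norm (x - a) / ((norm \<alpha> - norm \<beta>) * norm (x - a))"
        proof (rule frac_le)
          have "norm (\<alpha> * (x - a) * (q x - deriv f a) + \<beta> * cnj (x - a) * (cnj (q x) * \<kappa> x - deriv f a))
            \<le> norm (\<alpha> * (x - a) * (q x - deriv f a)) + norm (\<beta> * cnj (x - a) * (cnj (q x) * \<kappa> x - deriv f a))"
            by (rule norm_triangle_ineq)
          also have "\<dots> = (norm \<alpha> * norm (q x - deriv f a) + norm \<beta> * norm (cnj (q x) * \<kappa> x - deriv f a)) * norm (x - a)"
            unfolding norm_mult complex_mod_cnj by (simp add: algebra_simps)
          finally show "norm (\<alpha> * (x - a) * (q x - deriv f a) + \<beta> * cnj (x - a) * (cnj (q x) * \<kappa> x - deriv f a))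
            \<le> \<dots>" .
        qed (use l_ge[of x] elim \<alpha>\<beta> in auto)
        also have "\<dots> = e x" using elim by (simp add: e_def)
        finally show ?case .
      qed
    qed
    then have 2: "((\<lambda>x. H x / l x) \<longlongrightarrow> deriv f a) (at a)"
      by (simp add: LIM_zero_iff)
    have "((\<lambda>x. (f (G x) / l x) / (H x / l x)) \<longlongrightarrow> deriv f (G a) / deriv f a) (at a)"
      using 1 2 f'[OF True] by (intro tendsto_intros)
    moreover have "\<forall>\<^sub>F x in at a. (f (G x) / l x) / (H x / l x) = Q x"
      using nz[of a] eventually_neq_at_within[of a a UNIV]
      by eventually_elim (simp add: Q_def l0)
    ultimately have "(Q \<longlongrightarrow> deriv f (G a) / deriv f a) (at a)"
      using tendsto_cong by force
    then show ?thesis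
      using True by (simp add: isCont_def Q_def)
  qed
  then have "continuous_on UNIV Q"
    by (simp add: continuous_on_eq_continuous_at)
  then obtain L where L: "continuous_on UNIV L" "\<And>x. Q x = exp (L x)"
    using continuous_logarithm_on_contractible[of UNIV Q] Q0 convex_imp_contractible[OF convex_UNIV] by auto
  \<comment> \<open>Where \<open>f x \<noteq> 0\<close>, the product
    \<open>Q x * \<alpha> * \<rho> x\<close> is \<open>f (G x) / f x\<close>. Each factor has its
    own continuous logarithm there, and an \<open>n\<close>-th part of their sum gives the
    root.\<close>
  define \<mu> where "\<mu> = (\<lambda>x. exp ((L x + Ln \<alpha> + Ln (\<rho> x)) / of_nat n))"
  show ?thesis
  proof
    have "continuous_on {x. f x \<noteq> 0} f" "continuous_on {x. f x \<noteq> 0} \<kappa>"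
      using contf cont\<kappa> continuous_at_imp_continuous_on by blast+
    then have "continuous_on {x. f x \<noteq> 0} \<rho>"
      unfolding \<rho>_def by (intro continuous_intros) auto
    moreover have "\<rho> x \<notin> \<real>\<^sub>\<le>\<^sub>0" if "f x \<noteq> 0" for x
      using Re\<rho>[OF that] by (auto simp: complex_nonpos_Reals_iff)
    ultimately show "continuous_on {x. f x \<noteq> 0} \<mu>"
      unfolding \<mu>_def using n by (intro continuous_intros continuous_on_subset[OF L(1)]) auto
    show "\<mu> x \<noteq> 0" for x by (simp add: \<mu>_def)
    show "\<mu> x ^ n * f x = f (\<alpha> * x + \<beta> * cnj x + t)" if "f x \<noteq> 0" for x
    proof -
      have "\<mu> x ^ n = exp (L x + Ln \<alpha> + Ln (\<rho> x))"
        using n by (simp add: \<mu>_def flip: exp_of_nat_mult)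
      moreover have "\<rho> x \<noteq> 0"
        using Re\<rho>[OF that] by auto
      ultimately have "\<mu> x ^ n = Q x * \<alpha> * \<rho> x"
        using \<alpha>0 L(2)[of x] by (simp add: exp_add)
      then show ?thesis
        using that H0[OF that] H\<rho>[OF that] by (simp add: Q_def G_def field_simps)
    qed
  qed
qed

section \<open>Connectedness of the curve without its branch points\<close>

lemma path_connected_superelliptic_curve:
  fixes f :: "complex \<Rightarrow> complex"
  assumes f: "f holomorphic_on UNIV" and a: "f a = 0" "deriv f a \<noteq> 0"
    and P: "path_connected {x. f x \<noteq> 0}" and n: "n > 0"
  shows "path_connected {(x, w). w ^ n = f x \<and> f x \<noteq> 0}" (is "path_connected ?R")
proof -
  obtain r where r: "r > 0" "open (f ` ball a r)" "inj_on f (ball a r)"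
    using has_complex_derivative_locally_invertible[OF f _ _ a(2)] by auto
  obtain g where g_holo: "g holomorphic_on f ` ball a r" and gf: "\<And>x. x \<in> ball a r \<Longrightarrow> g (f x) = x"
    using holomorphic_has_inverse[OF holomorphic_on_subset[OF f subset_UNIV] open_ball r(3)] by metis
  have "0 \<in> f ` ball a r"
    using a(1) r(1) by (metis centre_in_ball imageI)
  then obtain e where e: "e > 0" "ball 0 e \<subseteq> f ` ball a r"
    using r(2) open_contains_ball by blast
  have fg: "f (g y) = y" if "norm y < e" for y
    using e(2) gf that by (force simp: subset_iff)
  \<comment> \<open>Chosen so that \<open>w ^ n\<close> stays in the disc on which \<open>g\<close>
    is a right inverse of \<open>f\<close>.\<close>
  define \<delta> where "\<delta> = root n e"
  have \<delta>: "\<delta> > 0" using n e(1) by (simp add: \<delta>_def)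
  have \<delta>e: "norm (w ^ n) < e" if "norm w < \<delta>" for w :: complex
    using power_strict_mono[OF that, of n] n e(1) by (simp add: norm_power \<delta>_def)
  txt \<open>
    As \<open>f\<close> is invertible near its simple zero \<open>a\<close>, the curve near \<open>(a, 0)\<close> is a disc parametrised
    by \<open>w\<close>; it connects all the points of a nearby fibre, and every point of the curve can be
    joined to that fibre by path lifting.
  \<close>
  define K where "K = (\<lambda>w. (g (w ^ n), w)) ` (ball 0 \<delta> - {0})"
  have "path_connected K"
    unfolding K_def
  proof (rule path_connected_continuous_image)
    show "continuous_on (ball 0 \<delta> - {0}) (\<lambda>w. (g (w ^ n), w))"
    proof (intro continuous_intros continuous_on_compose2[OF holomorphic_on_imp_continuous_on[OF g_holo]])
      show "(\<lambda>w. w ^ n) ` (ball 0 \<delta> - {0}) \<subseteq> f ` ball a r"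
        using e(2) \<delta>e by force
    qed
  qed (simp add: path_connected_punctured_ball)
  moreover have "K \<subseteq> ?R"
    using n by (auto simp: K_def fg \<delta>e)
  ultimately have K: "path_component ?R p q" if "p \<in> K" "q \<in> K" for p q
    using that path_component_of_subset[of K ?R p q] unfolding path_connected_component by blast
  \<comment> \<open>Any nonzero point of the disc would do. All \<open>n\<close>-th roots of
    \<open>w\<^sub>1 ^ n\<close> have the same modulus, so the whole fibre over
    \<open>x\<^sub>1\<close> lies in \<open>K\<close>.\<close>
  define w\<^sub>1 where "w\<^sub>1 = complex_of_real (\<delta> / 2)"
  define x\<^sub>1 where "x\<^sub>1 = g (w\<^sub>1 ^ n)"
  have w\<^sub>1: "w\<^sub>1 \<noteq> 0" "norm w\<^sub>1 < \<delta>"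
    using \<delta> by (simp_all add: w\<^sub>1_def)
  have fx\<^sub>1: "f x\<^sub>1 = w\<^sub>1 ^ n"
    using fg \<delta>e[OF w\<^sub>1(2)] by (simp add: x\<^sub>1_def)
  have fibre: "(x\<^sub>1, w) \<in> K" if "w ^ n = f x\<^sub>1" for w
  proof -
    have "norm w ^ n = norm w\<^sub>1 ^ n"
      using that fx\<^sub>1 by (metis norm_power)
    then have "norm w = norm w\<^sub>1"
      using n by (simp add: power_eq_iff_eq_base)
    then have "w \<in> ball 0 \<delta> - {0}"
      using w\<^sub>1 by auto
    then show ?thesis
      unfolding K_def using that fx\<^sub>1 by (intro image_eqI[of _ _ w]) (auto simp: x\<^sub>1_def)
  qed
  have to_fibre: "\<exists>w'. path_component ?R (x, w) (x\<^sub>1, w')" if xw: "(x, w) \<in> ?R" for x w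
  proof -
    have "x \<in> {x. f x \<noteq> 0}" "x\<^sub>1 \<in> {x. f x \<noteq> 0}"
      using xw fx\<^sub>1 w\<^sub>1 by auto
    then obtain \<gamma> where \<gamma>: "path \<gamma>" "path_image \<gamma> \<subseteq> {x. f x \<noteq> 0}" "pathstart \<gamma> = x" "pathfinish \<gamma> = x\<^sub>1"
      using P unfolding path_connected_def by blast
    have c\<gamma>: "continuous_on {0..1} \<gamma>"
      using \<gamma>(1) by (simp add: path_def)
    have "continuous_on {0..1} (f \<circ> \<gamma>)"
      by (intro continuous_on_compose c\<gamma> continuous_on_subset[OF holomorphic_on_imp_continuous_on[OF f]]) auto
    moreover have nz: "f (\<gamma> s) \<noteq> 0" if "s \<in> {0..1}" for s
      using \<gamma>(2) that by (fastforce simp: path_image_def)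
    ultimately obtain L where L: "continuous_on {0..1} L" "\<And>s. s \<in> {0..1} \<Longrightarrow> f (\<gamma> s) = exp (L s)"
      using continuous_logarithm_on_contractible[of "{0..1::real}" "f \<circ> \<gamma>"] convex_imp_contractible
      by (auto simp: o_def)
    \<comment> \<open>The lift of \<open>\<gamma>\<close>: the exponential is 1 at
      \<open>s = 0\<close>, so it starts at \<open>w\<close>, and its \<open>n\<close>-th power
      follows \<open>f\<close> along the path.\<close>
    define \<omega> where "\<omega> = (\<lambda>s. w * exp ((L s - L 0) / of_nat n))"
    have \<omega>n: "\<omega> s ^ n = f (\<gamma> s)" if "s \<in> {0..1}" for s
    proof -
      have "\<omega> s ^ n = w ^ n * exp (L s - L 0)"
        using n by (simp add: \<omega>_def power_mult_distrib flip: exp_of_nat_mult)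
      also have "w ^ n = exp (L 0)"
        using xw \<gamma>(3) L(2)[of 0] by (simp add: pathstart_def)
      finally show ?thesis
        using L(2)[OF that] by (simp add: exp_diff)
    qed
    have "path_component ?R (x, w) (x\<^sub>1, \<omega> 1)"
      unfolding path_component_def
    proof (intro exI conjI)
      show "path (\<lambda>s. (\<gamma> s, \<omega> s))"
        unfolding path_def \<omega>_def using n by (intro continuous_intros c\<gamma> L) auto
      show "path_image (\<lambda>s. (\<gamma> s, \<omega> s)) \<subseteq> ?R"
        using \<omega>n nz by (auto simp: path_image_def)
      show "pathstart (\<lambda>s. (\<gamma> s, \<omega> s)) = (x, w)" "pathfinish (\<lambda>s. (\<gamma> s, \<omega> s)) = (x\<^sub>1, \<omega> 1)"
        using \<gamma>(3,4) by (simp_all add: pathstart_def pathfinish_def \<omega>_def)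
    qed
    then show ?thesis by blast
  qed
  have in_fibre: "w' ^ n = f x\<^sub>1" if "path_component ?R p (x\<^sub>1, w')" for p w'
    using path_component_mem(2)[OF that] by simp
  have *: "path_component ?R p (x\<^sub>1, w\<^sub>1)" if p_in: "p \<in> ?R" for p
  proof -
    obtain x w where p: "p = (x, w)" by (cases p)
    obtain w' where w': "path_component ?R p (x\<^sub>1, w')"
      using to_fibre[OF p_in[unfolded p]] unfolding p by blast
    have "path_component ?R (x\<^sub>1, w') (x\<^sub>1, w\<^sub>1)"
      using K[OF fibre[OF in_fibre[OF w']] fibre[OF fx\<^sub>1[symmetric]]] .
    with w' show ?thesis by (rule path_component_trans)
  qed
  show ?thesis
    unfolding path_connected_component
    by (intro ballI path_component_trans[OF * path_component_sym[OF *]])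
qed

section \<open>Affine bijections and continuity of roots\<close>

lemma bij_affine:
  assumes "det A \<noteq> 0"
  obtains B where "\<And>x. B \<bullet>\<^sub>m ((A \<bullet>\<^sub>m x + t) - t) = x" "\<And>y. A \<bullet>\<^sub>m (B \<bullet>\<^sub>m (y - t)) + t = y"
    "bij (\<lambda>x. A \<bullet>\<^sub>m x + t)"
proof -
  obtain B where B: "A ** B = mat 1" "B ** A = mat 1"
    using assms by (metis invertible_def invertible_det_nz)
  have "bij (\<lambda>x. A \<bullet>\<^sub>m x + t)"
    by (rule o_bij[of "\<lambda>y. B \<bullet>\<^sub>m (y - t)"]) (auto simp: fun_eq_iff mat_act_mult B)
  then show ?thesis
    by (intro that[of B]) (simp_all add: mat_act_mult B)
qed

text \<open>At a zero of \<open>F\<close> the modulus of \<open>v\<close> is the real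
  \<open>n\<close>-th root of \<open>norm (F q)\<close> and tends to 0, whatever the branch. This
  extends the lifted maps continuously over the cone points.\<close>

lemma continuous_on_power_root:
  fixes v F :: "'a::topological_space \<Rightarrow> complex"
  assumes F: "continuous_on C F" and v: "continuous_on {p \<in> C. F p \<noteq> 0} v"
    and vF: "\<And>p. p \<in> C \<Longrightarrow> v p ^ n = F p" and n: "n > 0"
  shows "continuous_on C v"
  unfolding continuous_on_def
proof
  fix p assume p: "p \<in> C"
  show "(v \<longlongrightarrow> v p) (at p within C)"
  proof (cases "F p = 0")
    case True
    then have "v p = 0" using vF[OF p] n by simp
    have "continuous_on C (\<lambda>q. root n (norm (F q)))"
      by (intro continuous_intros F)
    then have lim: "((\<lambda>q. root n (norm (F q))) \<longlongrightarrow> 0) (at p within C)"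
      using p True by (auto simp: continuous_on_def)
    have "\<forall>\<^sub>F q in at p within C. root n (norm (F q)) = norm (v q)"
      unfolding eventually_at_filter
      by (rule always_eventually) (use n in \<open>auto simp: norm_power real_root_power_cancel simp flip: vF\<close>)
    from tendsto_norm_zero_cancel[OF Lim_transform_eventually[OF _ this]] show ?thesis
      using \<open>v p = 0\<close> lim by simp
  next
    case False
    \<comment> \<open>Near \<open>p\<close> the set where \<open>F\<close> is nonzero fills all of
      \<open>C\<close>, so limits within it are limits within \<open>C\<close>.\<close>
    have ne: "\<forall>\<^sub>F q in at p within C. F q \<noteq> 0"
      using F p False by (auto simp: continuous_on_def intro: tendsto_imp_eventually_ne)
    have "(v \<longlongrightarrow> v p) (at p within {p \<in> C. F p \<noteq> 0})"
      using v p False by (simp add: continuous_on_def)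
    then have v_in: "\<forall>\<^sub>F q in at p within {p \<in> C. F p \<noteq> 0}. v q \<in> U" if "open U" "v p \<in> U" for U
      using that by (simp add: tendsto_def)
    then have "\<forall>\<^sub>F q in at p within C. v q \<in> U" if "open U" "v p \<in> U" for U
    proof -
      have "\<forall>\<^sub>F q in nhds p. q \<noteq> p \<longrightarrow> q \<in> {p \<in> C. F p \<noteq> 0} \<longrightarrow> v q \<in> U"
        using v_in[OF that] unfolding eventually_at_filter by blast
      moreover have "\<forall>\<^sub>F q in nhds p. q \<noteq> p \<longrightarrow> q \<in> C \<longrightarrow> F q \<noteq> 0"
        using ne unfolding eventually_at_filter .
      ultimately show ?thesis
        unfolding eventually_at_filter by eventually_elim blast
    qed
    then show ?thesis
      by (simp add: tendsto_def)
  qed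
qed

section \<open>The Veech group of the punctured plane\<close>

text \<open>The common value of both Veech groups; the translation is only asserted to exist, since
  a differential forgets it.\<close>

definition affine_stabilizer :: "complex set \<Rightarrow> (real^2^2) set" where
  "affine_stabilizer Z = {A. det A > 0 \<and> (\<exists>t. (\<lambda>x. A \<bullet>\<^sub>m x + t) ` Z = Z)}"

text \<open>Uniqueness at a single regular point already makes the definite description well
  defined.\<close>

lemma differential_eqI:
  assumes "p \<in> topspace (regular_part S)"
    and "\<And>q. q \<in> topspace (regular_part S) \<Longrightarrow> affine_at S T q A"
    and "\<And>B. affine_at S T p B \<Longrightarrow> B = A"
  shows "differential S T = A"
  unfolding differential_def using assms by blast

text \<open>Diffeomorphisms act on the complement of the punctures, \<open>affine_stabilizer\<close>
  on the punctures; bijectivity translates between the two.\<close>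

lemma affine_image_Compl_iff:
  assumes "det A \<noteq> 0"
  shows "(\<lambda>x. A \<bullet>\<^sub>m x + t) ` (- Z) = - Z \<longleftrightarrow> (\<lambda>x. A \<bullet>\<^sub>m x + t) ` Z = Z"
proof -
  have "bij (\<lambda>x. A \<bullet>\<^sub>m x + t)" using bij_affine[OF assms] by blast
  then show ?thesis by (simp add: bij_image_Compl_eq)
qed

text \<open>An affine map is determined by its germ at any point, and a regular point exists because
  the punctures are countable.\<close>

lemma differential_punctured_plane:
  assumes lim: "filterlim (\<lambda>k. norm (z k)) at_top sequentially"
    and A: "det A > 0" "(\<lambda>x. A \<bullet>\<^sub>m x + t) ` range z = range z"
    and T: "\<And>x. x \<notin> range z \<Longrightarrow> T x = A \<bullet>\<^sub>m x + t"
  shows "differential (punctured_plane z) T = A"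
proof -
  have op: "open (- range z)"
    using closed_range_of_tendsto_infinity[OF lim] by auto
  have im: "(\<lambda>x. A \<bullet>\<^sub>m x + t) ` (- range z) = - range z"
    using A affine_image_Compl_iff[of A t "range z"] by simp
  then have TP: "T p \<notin> range z" if "p \<notin> range z" for p
    using that T im imageI[of p "- range z" "\<lambda>x. A \<bullet>\<^sub>m x + t"] by simp
  have "countable (range z)" by simp
  then have "range z \<noteq> UNIV"
    using uncountable_UNIV_complex by metis
  then obtain p where p: "p \<notin> range z" by blast
  show ?thesis
  proof (rule differential_eqI[of p])
    show "affine_at (punctured_plane z) T q A" if "q \<in> topspace (regular_part (punctured_plane z))" for q
    proof -
      have "q \<notin> range z" using that by simp
      moreover have "\<forall>x\<in>- range z. T x \<notin> range z \<and> T x = A \<bullet>\<^sub>m x + t"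
        using T TP by simp
      ultimately show ?thesis
        unfolding affine_at_punctured_plane[of z q T, OF op \<open>q \<notin> range z\<close> TP[OF \<open>q \<notin> range z\<close>]]
        using op by blast
    qed
    fix B assume "affine_at (punctured_plane z) T p B"
    then obtain s W where W: "open W" "p \<in> W" "W \<subseteq> - range z"
      and TW: "\<forall>q\<in>W. T q \<notin> range z \<and> T q = B \<bullet>\<^sub>m q + s"
      unfolding affine_at_punctured_plane[of z p T, OF op p TP[OF p]] by (elim exE conjE)
    show "B = A"
    proof (rule affine_germ_unique(1)[OF W(1,2)])
      fix q assume "q \<in> W"
      then have "T q = B \<bullet>\<^sub>m q + s" "q \<notin> range z"
        using TW W(3) by blast+
      then show "B \<bullet>\<^sub>m q + s = A \<bullet>\<^sub>m q + t"
        using T by metis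
    qed
  qed (use p in simp)
qed

lemma veech_group_punctured_plane:
  assumes "filterlim (\<lambda>k. norm (z k)) at_top sequentially"
  shows "veech_group (punctured_plane z) = affine_stabilizer (range z)"
proof (intro set_eqI iffI)
  fix A assume "A \<in> veech_group (punctured_plane z)"
  then obtain T where "T \<in> affine_diffeos_plus (punctured_plane z)" "A = differential (punctured_plane z) T"
    by (auto simp: veech_group_def)
  then show "A \<in> affine_stabilizer (range z)"
    unfolding affine_diffeos_plus_punctured_plane_iff[OF assms] affine_stabilizer_def
    by (fastforce simp: differential_punctured_plane[OF assms])
next
  fix A assume "A \<in> affine_stabilizer (range z)"
  then obtain t where A: "det A > 0" "(\<lambda>x. A \<bullet>\<^sub>m x + t) ` range z = range z"
    by (auto simp: affine_stabilizer_def)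
  then have "(\<lambda>x. A \<bullet>\<^sub>m x + t) \<in> affine_diffeos_plus (punctured_plane z)"
    using affine_diffeos_plus_punctured_plane_iff[OF assms] by blast
  then show "A \<in> veech_group (punctured_plane z)"
    unfolding veech_group_def
    by (rule image_eqI[rotated]) (rule differential_punctured_plane[OF assms A refl, symmetric])
qed

section \<open>The regular part of the superelliptic surface and its affine germs\<close>

locale superelliptic =
  fixes z :: "nat \<Rightarrow> complex" and f :: "complex \<Rightarrow> complex" and n :: nat
  assumes inj: "inj z"
    and lim: "filterlim (\<lambda>k. norm (z k)) at_top sequentially"
    and weierstrass: "weierstrass_map z f"
    and n: "n \<ge> 1"
begin

abbreviation "S \<equiv> superelliptic_surface n f z"
abbreviation "C \<equiv> superelliptic_curve n f"

text \<open>The regular part of the surface, described through \<open>f\<close> to match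
  \<open>path_connected_superelliptic_curve\<close>.\<close>

definition R :: "(complex \<times> complex) set" where
  "R = {(x, w). w ^ n = f x \<and> f x \<noteq> 0}"

lemma f_eq_0: "f x = 0 \<longleftrightarrow> x \<in> range z"
  by (rule weierstrass_map_eq_0_iff[OF weierstrass])

lemma f_holo: "f holomorphic_on UNIV"
  by (rule weierstrass_map_holomorphic[OF weierstrass])

text \<open>Over a zero of \<open>f\<close> the fibre is the single point with
  \<open>w = 0\<close>.\<close>

lemma curve_minus_cone_points [simp]: "C - range (\<lambda>k. (z k, 0)) = R"
proof -
  have "w = 0 \<longleftrightarrow> f x = 0" if "w ^ n = f x" for x w
    using n by (simp flip: that)
  then show ?thesis
    unfolding superelliptic_curve_def R_def using f_eq_0 by auto
qed

lemma cone_points_subset: "range (\<lambda>k. (z k, 0)) \<subseteq> C"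
  using n f_eq_0 by (auto simp: superelliptic_curve_def power_0_left)

lemma surface_simps [simp]:
  "regular_part S = top_of_set R" "total S = top_of_set C" "cone_points S = range (\<lambda>k. (z k, 0))"
  by simp (simp_all add: superelliptic_surface_def Let_def)

lemma fst_R: "fst ` R = - range z"
proof
  show "fst ` R \<subseteq> - range z" by (auto simp: R_def f_eq_0)
  show "- range z \<subseteq> fst ` R"
  proof
    fix x assume "x \<in> - range z"
    then have "f x \<noteq> 0" by (simp add: f_eq_0)
    then have "exp (Ln (f x) / of_nat n) ^ n = f x"
      using n by (simp flip: exp_of_nat_mult)
    then have "(x, exp (Ln (f x) / of_nat n)) \<in> R"
      using \<open>f x \<noteq> 0\<close> by (simp add: R_def)
    then show "x \<in> fst ` R" by force
  qed
qed

lemma R_nonempty: "R \<noteq> {}"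
proof -
  have "countable (range z)" by simp
  then have "- range z \<noteq> {}"
    using uncountable_UNIV_complex by (metis Compl_empty_eq double_compl)
  then show ?thesis using fst_R by blast
qed

lemma connected_R: "connected R"
proof -
  have "{x. f x \<noteq> 0} = - range z"
    using f_eq_0 by blast
  moreover have "path_connected (- range z)"
    by (rule path_connected_complement_countable) auto
  \<comment> \<open>The branch point around which the sheets are joined.\<close>
  moreover have "f (z 0) = 0"
    using f_eq_0 by blast
  ultimately show ?thesis
    unfolding R_def using n
    by (intro path_connected_imp_connected
        path_connected_superelliptic_curve[OF f_holo _ weierstrass_map_deriv_nonzero[OF inj weierstrass]]) auto
qed

lemma atlas_fst: "(U, \<phi>) \<in> atlas S \<Longrightarrow> \<phi> = fst"
  by (auto simp: superelliptic_surface_def Let_def punctured_plane_def pullback_atlas_def)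

lemma translation_atlas: "translation_atlas (top_of_set R) (atlas S)"
  using translation_surface_superelliptic_surface[OF lim weierstrass n]
  by (simp add: translation_surface_def)

lemma atlas_open: "(U, \<phi>) \<in> atlas S \<Longrightarrow> openin (top_of_set R) U"
  using translation_atlas unfolding translation_atlas_def by blast

lemma exists_chart:
  assumes "p \<in> R"
  obtains U where "(U, fst) \<in> atlas S" "p \<in> U"
proof -
  have "p \<in> (\<Union>(U, \<phi>)\<in>atlas S. U)"
    using translation_atlas assms unfolding translation_atlas_def by simp
  then show ?thesis using that atlas_fst by auto
qed

text \<open>Locally \<open>fst\<close> is a chart, hence open. Germs on the curve can therefore be
  compared in the plane.\<close>

lemma open_fst_image:
  assumes W: "openin (top_of_set R) W"
  shows "open (fst ` W)"
proof (subst open_subopen, intro ballI)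
  fix x assume "x \<in> fst ` W"
  then obtain p where p: "p \<in> W" "x = fst p" by blast
  then have "p \<in> R" using openin_imp_subset[OF W] by blast
  then obtain U where U: "(U, fst) \<in> atlas S" "p \<in> U"
    by (rule exists_chart)
  have *: "openin (top_of_set R) U" "open (fst ` U)"
      "homeomorphic_map (subtopology (top_of_set R) U) (top_of_set (fst ` U)) fst"
    using translation_atlas U(1) unfolding translation_atlas_def by auto
  have "openin (subtopology (top_of_set R) U) (W \<inter> U)"
    using W by (auto simp: openin_subtopology)
  then have "openin (top_of_set (fst ` U)) (fst ` (W \<inter> U))"
    using homeomorphic_imp_open_map[OF *(3)] by (simp add: open_map_def)
  then have "open (fst ` (W \<inter> U))"
    using *(2) openin_open_eq by blast
  then show "\<exists>T. open T \<and> x \<in> T \<and> T \<subseteq> fst ` W"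
    using p U(2) by (intro exI[of _ "fst ` (W \<inter> U)"]) auto
qed

text \<open>Every chart is a restriction of \<open>fst\<close>, so the atlas disappears from the
  condition; the domain \<open>W\<close> is kept so that overlapping germs can be compared.\<close>

definition affine_germ :: "(complex \<times> complex \<Rightarrow> complex \<times> complex) \<Rightarrow> complex \<times> complex \<Rightarrow>
    real^2^2 \<Rightarrow> complex \<Rightarrow> (complex \<times> complex) set \<Rightarrow> bool" where
  "affine_germ T p A t W \<longleftrightarrow>
     openin (top_of_set R) W \<and> p \<in> W \<and> (\<forall>q\<in>W. fst (T q) = A \<bullet>\<^sub>m fst q + t)"

text \<open>The overlap projects to a nonempty open set of the plane, where
  \<open>affine_germ_unique\<close> applies.\<close>

lemma affine_germ_eq:
  assumes "affine_germ T p A t W" "affine_germ T q B s V" "r \<in> W" "r \<in> V"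
  shows "A = B" "t = s"
proof -
  have WV: "openin (top_of_set R) (W \<inter> V)"
    using assms by (auto simp: affine_germ_def intro: openin_Int)
  have eq: "A \<bullet>\<^sub>m x + t = B \<bullet>\<^sub>m x + s" if "x \<in> fst ` (W \<inter> V)" for x
    using assms that unfolding affine_germ_def by force
  have "fst r \<in> fst ` (W \<inter> V)"
    using assms by blast
  from affine_germ_unique[OF open_fst_image[OF WV] this eq]
  show "A = B" "t = s" by auto
qed

text \<open>All coordinates are \<open>fst\<close>, and continuity of \<open>T\<close> lets a germ
  be shrunk until it fits any pair of charts.\<close>

lemma affine_at_iff:
  assumes T: "continuous_on R T" "T ` R \<subseteq> R" and p: "p \<in> R"
  shows "affine_at S T p A \<longleftrightarrow> (\<exists>t W. affine_germ T p A t W)"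
proof
  assume *: "affine_at S T p A"
  obtain U where U: "(U, fst) \<in> atlas S" "p \<in> U"
    using exists_chart[OF p] .
  have "T p \<in> R" using T p by blast
  then obtain V where V: "(V, fst) \<in> atlas S" "T p \<in> V"
    by (rule exists_chart)
  have "\<exists>t W. openin (regular_part S) W \<and> p \<in> W \<and> W \<subseteq> U \<and>
      (\<forall>q\<in>W. T q \<in> V \<and> fst (T q) = A \<bullet>\<^sub>m fst q + t)"
    using bspec[OF bspec[OF *[unfolded affine_at_def] U(1), unfolded prod.case] V(1), unfolded prod.case]
      U(2) V(2) by simp
  then show "\<exists>t W. affine_germ T p A t W"
    unfolding affine_germ_def surface_simps by (elim ex_forward) blast
next
  assume "\<exists>t W. affine_germ T p A t W"
  then obtain t W where W: "openin (top_of_set R) W" "p \<in> W"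
      "\<And>q. q \<in> W \<Longrightarrow> fst (T q) = A \<bullet>\<^sub>m fst q + t"
    unfolding affine_germ_def by blast
  show "affine_at S T p A"
    unfolding affine_at_def
  proof (clarify)
    fix U \<phi> V \<psi> assume *: "(U, \<phi>) \<in> atlas S" "(V, \<psi>) \<in> atlas S" "p \<in> U" "T p \<in> V"
    have "openin (top_of_set R) (R \<inter> T -` V)"
      using T atlas_open[OF *(2)] by (intro continuous_openin_preimage[of R T R V]) auto
    from openin_Int[OF openin_Int[OF W(1) atlas_open[OF *(1)]] this]
    have "openin (top_of_set R) (W \<inter> U \<inter> (R \<inter> T -` V))" .
    then show "\<exists>t W. openin (regular_part S) W \<and> p \<in> W \<and> W \<subseteq> U \<and>
        (\<forall>q\<in>W. T q \<in> V \<and> \<psi> (T q) = A \<bullet>\<^sub>m \<phi> q + t)"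
      using W p * atlas_fst[OF *(1)] atlas_fst[OF *(2)]
      by (intro exI[of _ t] exI[of _ "W \<inter> U \<inter> (R \<inter> T -` V)"]) (simp add: le_infI1)
  qed
qed

text \<open>A global formula is a germ with domain \<open>R\<close>, which meets every other
  germ.\<close>

lemma differential_superelliptic:
  assumes T: "continuous_on R T" "T ` R \<subseteq> R" and A: "\<And>p. p \<in> R \<Longrightarrow> fst (T p) = A \<bullet>\<^sub>m fst p + t"
    and p: "p \<in> R"
  shows "affine_at S T p B \<longleftrightarrow> B = A" "differential S T = A"
proof -
  have germ: "affine_germ T q A t R" if "q \<in> R" for q
    using that A by (simp add: affine_germ_def)
  have *: "affine_at S T q B \<longleftrightarrow> B = A" if q: "q \<in> R" for q B
  proof
    assume "affine_at S T q B"
    then obtain s W where W: "affine_germ T q B s W"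
      unfolding affine_at_iff[OF T q] by blast
    then have "q \<in> W" by (simp add: affine_germ_def)
    from affine_germ_eq(1)[OF W germ[OF q] this q] show "B = A" .
  next
    assume "B = A"
    then show "affine_at S T q B"
      unfolding affine_at_iff[OF T q] using germ[OF q] by blast
  qed
  show "affine_at S T p B \<longleftrightarrow> B = A" using *[OF p] .
  show "differential S T = A"
    by (rule differential_eqI[of p]) (use p * in auto)
qed

section \<open>Projecting affine diffeomorphisms to the plane and lifting affine maps\<close>

lemma affine_diffeo_projects:
  assumes T: "T \<in> affine_diffeos_plus S"
  obtains A t where "det A > 0" "(\<lambda>x. A \<bullet>\<^sub>m x + t) ` range z = range z" "differential S T = A"
proof -
  have hom: "homeomorphic_map (top_of_set C) (top_of_set C) T"
    and cone: "T ` range (\<lambda>k. (z k, 0)) = range (\<lambda>k. (z k, 0))"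
    using T by (simp_all add: affine_diffeos_plus_def affine_diffeos_def)
  have TC: "continuous_on C T" "T ` C = C" "inj_on T C"
    using hom homeomorphic_imp_continuous_map homeomorphic_imp_surjective_map homeomorphic_imp_injective_map
    by fastforce+
  have TR: "T ` R = R"
    using inj_on_image_set_diff[OF TC(3) Diff_subset cone_points_subset] TC(2) cone
    unfolding curve_minus_cone_points by simp
  have cT: "continuous_on R T"
    using continuous_on_subset[OF TC(1)] curve_minus_cone_points by blast
  have TR': "T ` R \<subseteq> R" using TR by simp
  have "\<exists>A t W. det A > 0 \<and> affine_germ T p A t W" if p: "p \<in> R" for p
  proof -
    obtain A where A: "affine_at S T p A"
      using T p unfolding affine_diffeos_plus_def affine_diffeos_def surface_simps topspace_euclidean_subtopology
      by blast
    moreover have "det A > 0"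
      using T p A unfolding affine_diffeos_plus_def surface_simps topspace_euclidean_subtopology by blast
    ultimately show ?thesis
      unfolding affine_at_iff[OF cT TR' p] by blast
  qed
  then obtain A t W where W: "\<And>p. p \<in> R \<Longrightarrow> det (A p) > 0"
      "\<And>p. p \<in> R \<Longrightarrow> affine_germ T p (A p) (t p) (W p)"
    by metis
  have Wp: "openin (top_of_set R) (W p)" "p \<in> W p" "W p \<subseteq> R" if "p \<in> R" for p
    using W(2)[OF that] openin_imp_subset by (auto simp: affine_germ_def)
  have "(\<lambda>p. (A p, t p)) constant_on R"
  proof (rule locally_constant_imp_constant[OF connected_R])
    fix a assume a: "a \<in> R"
    \<comment> \<open>The germs chosen at \<open>a\<close> and at \<open>b\<close> share the point
      \<open>b\<close>.\<close>
    have "(A b, t b) = (A a, t a)" if b: "b \<in> W a" for b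
    proof -
      have bR: "b \<in> R" using Wp(3)[OF a] b by blast
      show ?thesis
        using affine_germ_eq[OF W(2)[OF bR] W(2)[OF a] Wp(2)[OF bR] b] by simp
    qed
    then show "\<exists>V. openin (top_of_set R) V \<and> a \<in> V \<and> (\<forall>x\<in>V. (A x, t x) = (A a, t a))"
      using Wp[OF a] by blast
  qed
  then obtain B s where B: "\<And>p. p \<in> R \<Longrightarrow> A p = B \<and> t p = s"
    unfolding constant_on_def by (metis prod.inject surj_pair)
  have TB: "fst (T p) = B \<bullet>\<^sub>m fst p + s" if "p \<in> R" for p
    using W(2)[OF that] B[OF that] by (simp add: affine_germ_def)
  obtain p where p: "p \<in> R" using R_nonempty by blast
  have dB: "det B > 0" using W(1)[OF p] B[OF p] by simp
  have "(\<lambda>x. B \<bullet>\<^sub>m x + s) ` (- range z) = fst ` T ` R"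
    unfolding fst_R[symmetric] image_image using TB by (intro image_cong) auto
  then have "(\<lambda>x. B \<bullet>\<^sub>m x + s) ` range z = range z"
    using affine_image_Compl_iff[of B s "range z"] dB by (simp add: TR fst_R)
  then show ?thesis
    using that[OF dB] differential_superelliptic(2)[OF cT TR' TB p] by blast
qed

text \<open>The root \<open>\<mu>\<close> is continuous only off the zeros of \<open>f\<close>. At
  the cone points continuity comes from \<open>continuous_on_power_root\<close>, because the second
  coordinate of the lift, and of its inverse, is an \<open>n\<close>-th root of a continuous
  function.\<close>

lemma affine_diffeo_lifts:
  assumes A: "det A > 0" and im: "(\<lambda>x. A \<bullet>\<^sub>m x + t) ` range z = range z"
  obtains T where "T \<in> affine_diffeos_plus S" "differential S T = A"
proof -
  define G where "G = (\<lambda>x. A \<bullet>\<^sub>m x + t)"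
  obtain B where B: "\<And>x. B \<bullet>\<^sub>m (G x - t) = x" "\<And>y. G (B \<bullet>\<^sub>m (y - t)) = y" and "bij G"
    using bij_affine[of A t] A unfolding G_def by auto
  have cont: "continuous_on X G" for X
    unfolding G_def by (intro continuous_intros)
  have cf: "continuous_on X f" for X
    using holomorphic_on_imp_continuous_on[OF f_holo] continuous_on_subset by blast
  have im': "G ` range z = range z" using im by (simp add: G_def)
  have "G x \<in> range z \<longleftrightarrow> x \<in> range z" for x
    using im' bij_is_inj[OF \<open>bij G\<close>] by (metis inj_image_mem_iff)
  then have fG: "f (G x) = 0 \<longleftrightarrow> f x = 0" for x
    by (simp add: f_eq_0)
  obtain \<alpha> \<beta> where \<alpha>\<beta>: "\<And>x. A \<bullet>\<^sub>m x = \<alpha> * x + \<beta> * cnj x" "det A = (norm \<alpha>)\<^sup>2 - (norm \<beta>)\<^sup>2"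
    using mat_act_conv_cnj[of A] by blast
  have less: "norm \<beta> < norm \<alpha>"
    using A \<alpha>\<beta>(2) by (simp add: power2_less_imp_less)
  have deriv: "deriv f x \<noteq> 0" if "f x = 0" for x
    using that weierstrass_map_deriv_nonzero[OF inj weierstrass] by (auto simp: f_eq_0)
  have zero: "f (\<alpha> * x + \<beta> * cnj x + t) = 0 \<longleftrightarrow> f x = 0" for x
    using fG[of x] by (simp add: G_def \<alpha>\<beta>(1))
  have "n > 0" using n by simp
  obtain \<mu> where \<mu>: "continuous_on {x. f x \<noteq> 0} \<mu>" "\<And>x. \<mu> x \<noteq> 0"
    and *: "\<And>x. f x \<noteq> 0 \<Longrightarrow> \<mu> x ^ n * f x = f (\<alpha> * x + \<beta> * cnj x + t)"
    using nth_root_of_affine_quotient[of f \<beta> \<alpha> t n, OF f_holo deriv less zero \<open>n > 0\<close>] by blast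
  have \<mu>_pow: "\<mu> x ^ n * f x = f (G x)" if "f x \<noteq> 0" for x
    using *[OF that] by (simp add: G_def \<alpha>\<beta>(1))
  define T where "T = (\<lambda>(x, w). (G x, \<mu> x * w))"
  \<comment> \<open>The inverse of \<open>T\<close>; the division is harmless even over the
    punctures, since \<open>\<mu>\<close> vanishes nowhere.\<close>
  define T' where "T' = (\<lambda>(y, v). (B \<bullet>\<^sub>m (y - t), v / \<mu> (B \<bullet>\<^sub>m (y - t))))"
  \<comment> \<open>Over a zero of \<open>f\<close>, where \<open>\<mu>_pow\<close> is silent,
    \<open>w = 0\<close> and both sides vanish.\<close>
  have \<mu>n: "(\<mu> x * w) ^ n = f (G x)" if "w ^ n = f x" for x w
    using that \<mu>_pow[of x] fG[of x] n by (cases "f x = 0") (auto simp: power_mult_distrib)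
  have T'C: "(v / \<mu> x) ^ n = f x" if "v ^ n = f (G x)" for x v
    using that \<mu>(2)[of x] \<mu>_pow[of x] fG[of x] n by (cases "f x = 0") (auto simp: power_divide field_simps)
  have "homeomorphism C C T T'"
  proof (rule homeomorphismI)
    have "continuous_on C (\<lambda>p. \<mu> (fst p) * snd p)"
    proof (rule continuous_on_power_root)
      show "continuous_on C (\<lambda>p. f (G (fst p)))"
        by (intro continuous_on_compose2[OF cf[of UNIV]] continuous_on_compose2[OF cont[of UNIV]] continuous_intros) auto
      show "continuous_on {p \<in> C. f (G (fst p)) \<noteq> 0} (\<lambda>p. \<mu> (fst p) * snd p)"
        by (intro continuous_intros continuous_on_compose2[OF \<mu>(1)]) (auto simp: fG)
    qed (use n in \<open>auto simp: superelliptic_curve_def intro!: \<mu>n\<close>)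
    moreover have "continuous_on C (\<lambda>p. G (fst p))"
      by (intro continuous_intros continuous_on_compose2[OF cont[of UNIV]]) auto
    ultimately show "continuous_on C T"
      unfolding T_def case_prod_beta by (rule continuous_on_Pair[rotated])
    have "continuous_on C (\<lambda>p. snd p / \<mu> (B \<bullet>\<^sub>m (fst p - t)))"
    proof (rule continuous_on_power_root)
      show "continuous_on C (\<lambda>p. f (B \<bullet>\<^sub>m (fst p - t)))"
        by (intro continuous_on_compose2[OF cf[of UNIV]] continuous_intros) auto
      show "continuous_on {p \<in> C. f (B \<bullet>\<^sub>m (fst p - t)) \<noteq> 0} (\<lambda>p. snd p / \<mu> (B \<bullet>\<^sub>m (fst p - t)))"
        by (intro continuous_intros continuous_on_compose2[OF \<mu>(1)]) (auto simp: \<mu>(2))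
    qed (use n in \<open>auto simp: superelliptic_curve_def B(2) intro!: T'C\<close>)
    moreover have "continuous_on C (\<lambda>p. B \<bullet>\<^sub>m (fst p - t))"
      by (intro continuous_intros)
    ultimately show "continuous_on C T'"
      unfolding T'_def case_prod_beta by (rule continuous_on_Pair[rotated])
    show "T ` C \<subseteq> C"
      by (auto simp: T_def superelliptic_curve_def \<mu>n)
    show "T' ` C \<subseteq> C"
      by (auto simp: T'_def superelliptic_curve_def B(2) intro!: T'C)
    show "T' (T p) = p" "T (T' p) = p" for p
      by (auto simp: T_def T'_def B \<mu>(2) split: prod.split)
  qed
  then have hom: "homeomorphic_map (top_of_set C) (top_of_set C) T" and cT: "continuous_on C T"
    by (auto simp: homeomorphism_imp_homeomorphic_map homeomorphism_def)
  have "T ` range (\<lambda>k. (z k, 0)) = (\<lambda>x. (x, 0)) ` G ` range z"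
    by (simp add: image_image T_def)
  then have cone: "T ` range (\<lambda>k. (z k, 0)) = range (\<lambda>k. (z k, 0))"
    unfolding im' by (simp add: image_image)
  have TR: "T ` R \<subseteq> R"
    by (auto simp: T_def R_def \<mu>n fG)
  have cTR: "continuous_on R T"
    using continuous_on_subset[OF cT] curve_minus_cone_points by blast
  have TA: "fst (T p) = A \<bullet>\<^sub>m fst p + t" for p
    by (simp add: T_def G_def case_prod_beta)
  note D = differential_superelliptic[OF cTR TR TA]
  have "invertible A" using A by (simp add: invertible_det_nz)
  then have "T \<in> affine_diffeos_plus S"
    using hom cone D(1) A by (simp add: affine_diffeos_plus_def affine_diffeos_def)
  moreover obtain p where "p \<in> R" using R_nonempty by blast
  ultimately show ?thesis
    using that D(2) by blast
qed

lemma veech_group_superelliptic: "veech_group S = affine_stabilizer (range z)"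
proof (intro set_eqI iffI)
  fix A assume "A \<in> veech_group S"
  then obtain T where T: "T \<in> affine_diffeos_plus S" "A = differential S T"
    by (auto simp: veech_group_def)
  show "A \<in> affine_stabilizer (range z)"
    using affine_diffeo_projects[OF T(1)] T(2) unfolding affine_stabilizer_def by blast
next
  fix A assume "A \<in> affine_stabilizer (range z)"
  then obtain t where A: "det A > 0" "(\<lambda>x. A \<bullet>\<^sub>m x + t) ` range z = range z"
    by (auto simp: affine_stabilizer_def)
  obtain T where "T \<in> affine_diffeos_plus S" "differential S T = A"
    using affine_diffeo_lifts[OF A] .
  then show "A \<in> veech_group S"
    unfolding veech_group_def by blast
qed

end

theorem corollary2p9:
  fixes z :: "nat \<Rightarrow> complex" and f :: "complex \<Rightarrow> complex" and n :: nat
  assumes "inj z"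
    and "filterlim (\<lambda>k. norm (z k)) at_top sequentially"
    and "weierstrass_map z f"
    and "n \<ge> 2"
  shows "veech_group (punctured_plane z) = veech_group (superelliptic_surface n f z)"
proof -
  interpret superelliptic z f n
    using assms by unfold_locales auto
  show ?thesis
    by (simp only: veech_group_punctured_plane[OF assms(2)] veech_group_superelliptic)
qed

end
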